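(* Let $L\subseteq L_\beta$ be a lattice of rank $n$, and assume that $\{d_1\mathbf m_1,\dots,d_n\mathbf m_n\}$ is a basis of $L$ such that $\{\mathbf m_1,\dots,\mathbf m_n\}$ is a basis of $L_\beta$, where $d_1,\dots,d_n$ are the invariant factors of $L_\beta/L$. If $P_i$ is the Newton polytope of the binomial $F_i=\mathbf x^{d_i\mathbf m_i^+}-\mathbf x^{d_i\mathbf m_i^-}$ for $i\in\{1,\dots,n\}$, then the degree of $I_L$ is the mixed volume $n!\,V(P_1,\dots,P_n)$.
   Context: $\mathbb K$ is a field. $\Sigma$ is a complete simplicial fan in $\mathbb R^n$ with rays $\rho_1,\dots,\rho_r$ generated by primitive lattice vectors $\mathbf v_1,\dots,\mathbf v_r\in\mathbb Z^n$, such that the corresponding $n$-dimensional split toric variety $X=X_\Sigma$ over $\mathbb K$ is smooth and projective; its class group $\operatorname{Cl}X$ is free. Let $\phi:\mathbb Z^n\to\mathbb Z^r$ be the $r\times n$ matrix with rows $\mathbf v_1,\dots,\mathbf v_r$, let $d=r-n$, and let $\beta:\mathbb Z^r\to\mathbb Z^d\cong \operatorname{Cl}X$ be an integer matrix such that $0\to\mathbb Z^n\xrightarrow{\phi}\mathbb Z^r\xrightarrow{\beta}\mathbb Z^d\to0$ is exact. $L_\beta=\operatorname{im}\phi=\ker\beta\subseteq\mathbb Z^r$, a lattice of rank $n$. The Cox ring $S=\mathbb K[x_1,\dots,x_r]$ is graded by $\deg x_j=\beta_j$, the $j$-th column of $\beta$. For $L\subseteq L_\beta$, the lattice ideal is $I_L=\langle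 \mathbf x^{\mathbf m^+}-\mathbf x^{\mathbf m^-} : \mathbf m=\mathbf m^+-\mathbf m^-\in L\rangle\subseteq S$, where $\mathbf m^{\pm}\in\mathbb N^r$ are the positive and negative parts of $\mathbf m$. Degree: for a graded $S$-module $M$, $H_M(\alpha)=\dim_{\mathbb K}M_\alpha$, and the multigraded Hilbert polynomial of $M$ (Maclagan–Smith) is the polynomial $P_M\in\mathbb Q[t_1,\dots,t_d]$ with $P_M(\alpha)=H_M(\alpha)$ for all $\alpha$ in some translate of the semigroup $\mathcal K=\bigcap_{\sigma\in\Sigma}\mathbb N\{\beta_i:\rho_i\not\subseteq\sigma\}$ of nef degrees. The degree of an ideal $I$ for which $P_{S/I}$ is constant is that constant. Newton polytopes and mixed volume: the Newton polytope of $F_i$ is the segment joining the exponent vectors $d_i\mathbf m_i^+$ and $d_i\mathbf m_i^-$; its direction $d_i\mathbf m_i$ lies in $L_\beta\otimes\mathbb R$, and it is regarded, up to translation, as a lattice polytope in $L_\beta\otimes\mathbb R\cong\mathbb R^n$ via $\phi$ (so that $L_\beta$ corresponds to $\mathbb Z^n$). $V(P_1,\dots,P_n)$ is the symmetric multilinear (under Minkowski sum) function of polytopes in $\mathbb R^n$ with $V(P,\dots,P)=\operatorname{Vol}_n(P)$, where $\operatorname{Vol}_n$ is Euclidean volume normalized so that the unit cube of $\mathbb Z^n$ has volume $1$. Invariant factors of $L_\beta/L$: the positive integers $d_1\mid d_2\mid\cdots\mid d_n$ (the value $1$ allowed) such that $L_\beta$ has a basis $\mathbf m_1,\dots,\mathbf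 m_n$ with $d_1\mathbf m_1,\dots,d_n\mathbf m_n$ a basis of $L$. *)

theory Defs
  imports "HOL-Analysis.Analysis" "HOL-Library.Poly_Mapping"
begin

section \<open>Lattices\<close>

definition real_vec :: "int^'i \<Rightarrow> real^'i" where
  "real_vec v = (\<chi> j. real_of_int (v $ j))"

definition lattice_basis :: "(nat \<Rightarrow> int^'i) \<Rightarrow> nat \<Rightarrow> (int^'i) set \<Rightarrow> bool" where
  "lattice_basis b k L \<longleftrightarrow>
     L = range (\<lambda>c :: nat \<Rightarrow> int. \<Sum>i=1..k. c i *s b i) \<and>
     (\<forall>c :: nat \<Rightarrow> int. (\<Sum>i=1..k. c i *s b i) = 0 \<longrightarrow> (\<forall>i\<in>{1..k}. c i = 0))"

definition lattice_of_rank :: "(int^'i) set \<Rightarrow> nat \<Rightarrow> bool" where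
  "lattice_of_rank L k \<longleftrightarrow> (\<exists>b. lattice_basis b k L)"

definition invariant_factors :: "nat \<Rightarrow> (int^'i) set \<Rightarrow> (int^'i) set \<Rightarrow> (nat \<Rightarrow> nat) \<Rightarrow> bool" where
  "invariant_factors k M L d \<longleftrightarrow>
     (\<forall>i\<in>{1..k}. 0 < d i) \<and> (\<forall>i\<in>{1..<k}. d i dvd d (Suc i)) \<and>
     (\<exists>b. lattice_basis b k M \<and> lattice_basis (\<lambda>i. int (d i) *s b i) k L)"

definition short_exact :: "int^'n^'r \<Rightarrow> int^'r^'d \<Rightarrow> bool" where
  "short_exact phi beta \<longleftrightarrow>
     inj ((*v) phi) \<and> range ((*v) phi) = {u. beta *v u = 0} \<and> surj ((*v) beta)"


section \<open>Fans\<close>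

definition strongly_convex_rational_cone :: "(real^'n) set \<Rightarrow> bool" where
  "strongly_convex_rational_cone \<sigma> \<longleftrightarrow>
     (\<exists>G. finite G \<and> \<sigma> = convex_cone hull (real_vec ` G)) \<and> \<sigma> \<inter> uminus ` \<sigma> = {0}"

text \<open>The empty set is a face in the sense of \<^const>\<open>face_of\<close>, but it is not a cone.\<close>

definition fan :: "(real^'n) set set \<Rightarrow> bool" where
  "fan \<Sigma> \<longleftrightarrow>
     finite \<Sigma> \<and> \<Sigma> \<noteq> {} \<and> (\<forall>\<sigma>\<in>\<Sigma>. strongly_convex_rational_cone \<sigma>) \<and>
     (\<forall>\<sigma>\<in>\<Sigma>. \<forall>\<tau>. \<tau> face_of \<sigma> \<and> \<tau> \<noteq> {} \<longrightarrow> \<tau> \<in> \<Sigma>) \<and>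
     (\<forall>\<sigma>\<in>\<Sigma>. \<forall>\<tau>\<in>\<Sigma>. (\<sigma> \<inter> \<tau>) face_of \<sigma> \<and> (\<sigma> \<inter> \<tau>) face_of \<tau>)"

definition complete_fan :: "(real^'n) set set \<Rightarrow> bool" where
  "complete_fan \<Sigma> \<longleftrightarrow> \<Union>\<Sigma> = UNIV"

definition simplicial_fan :: "(real^'n) set set \<Rightarrow> bool" where
  "simplicial_fan \<Sigma> \<longleftrightarrow> (\<forall>\<sigma>\<in>\<Sigma>. \<exists>G. independent G \<and> \<sigma> = convex_cone hull G)"

text \<open>A split toric variety is smooth iff every cone of its fan is generated by part of a
  \<open>\<int>\<close>-basis of the lattice, and a complete one is projective iff its fan is the (inner) normal
  fan of a full-dimensional lattice polytope. These are the two properties of the fan below.\<close>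

definition smooth_fan :: "(real^'n) set set \<Rightarrow> bool" where
  "smooth_fan \<Sigma> \<longleftrightarrow>
     (\<forall>\<sigma>\<in>\<Sigma>. \<exists>b J. lattice_basis b CARD('n) (UNIV :: (int^'n) set) \<and>
        J \<subseteq> {1..CARD('n)} \<and> \<sigma> = convex_cone hull ((\<lambda>i. real_vec (b i)) ` J))"

definition normal_cone :: "(real^'n) set \<Rightarrow> (real^'n) set \<Rightarrow> (real^'n) set" where
  "normal_cone P Q = {u. \<forall>x\<in>Q. \<forall>y\<in>P. u \<bullet> x \<le> u \<bullet> y}"

definition projective_fan :: "(real^'n) set set \<Rightarrow> bool" where
  "projective_fan \<Sigma> \<longleftrightarrow>
     (\<exists>G P. finite G \<and> P = convex hull (real_vec ` G) \<and> aff_dim P = int CARD('n) \<and>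
        \<Sigma> = {normal_cone P Q | Q. Q face_of P \<and> Q \<noteq> {}})"

definition ray :: "int^'n \<Rightarrow> (real^'n) set" where
  "ray v = {t *\<^sub>R real_vec v | t. 0 \<le> t}"

definition primitive_vec :: "int^'n \<Rightarrow> bool" where
  "primitive_vec v \<longleftrightarrow> v \<noteq> 0 \<and> (\<forall>k w. v = k *s w \<longrightarrow> \<bar>k\<bar> = 1)"

text \<open>The rows of \<open>phi\<close> are the primitive generators of the rays, each ray occurring once.\<close>

definition primitive_ray_matrix :: "(real^'n) set set \<Rightarrow> int^'n^'r \<Rightarrow> bool" where
  "primitive_ray_matrix \<Sigma> phi \<longleftrightarrow>
     (\<forall>i. primitive_vec (row i phi)) \<and>
     bij_betw (\<lambda>i. ray (row i phi)) UNIV {\<rho>\<in>\<Sigma>. dim \<rho> = 1}"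

text \<open>The semigroup \<open>\<K>\<close> of nef degrees.\<close>

definition nef_degrees :: "(real^'n) set set \<Rightarrow> int^'n^'r \<Rightarrow> int^'r^'d \<Rightarrow> (int^'d) set" where
  "nef_degrees \<Sigma> phi beta =
     (\<Inter>\<sigma>\<in>\<Sigma>. {\<Sum>i\<in>UNIV. int (c i) *s column i beta | c :: 'r \<Rightarrow> nat.
                  \<forall>i. ray (row i phi) \<subseteq> \<sigma> \<longrightarrow> c i = 0})"


section \<open>Polynomials, the Cox ring and lattice ideals\<close>

text \<open>Polynomials in variables indexed by \<open>'i\<close>: finitely supported functions on exponent vectors,
  with convolution as multiplication.\<close>

type_synonym ('i, 'a) mpoly = "(nat^'i) \<Rightarrow>\<^sub>0 'a"

definition monomial :: "nat^'i \<Rightarrow> ('i::finite, 'a::comm_ring_1) mpoly" where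
  "monomial u = Poly_Mapping.single u 1"

definition const_poly :: "'a \<Rightarrow> ('i::finite, 'a::comm_ring_1) mpoly" where
  "const_poly c = Poly_Mapping.single 0 c"

definition eval_poly :: "('i::finite, rat) mpoly \<Rightarrow> int^'i \<Rightarrow> rat" where
  "eval_poly p a =
     (\<Sum>e\<in>Poly_Mapping.keys p.
        Poly_Mapping.lookup p e * (\<Prod>j\<in>UNIV. of_int (a $ j) ^ (e $ j)))"

definition ideal_generated :: "('i::finite, 'k::field) mpoly set \<Rightarrow> ('i, 'k) mpoly set" where
  "ideal_generated G = module.span (*) G"

definition pos_part :: "int^'i \<Rightarrow> nat^'i" where
  "pos_part m = (\<chi> j. nat (m $ j))"

definition neg_part :: "int^'i \<Rightarrow> nat^'i" where
  "neg_part m = (\<chi> j. nat (- (m $ j)))"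

definition lattice_ideal :: "(int^'r) set \<Rightarrow> ('r, 'k::field) mpoly set" where
  "lattice_ideal L = ideal_generated ((\<lambda>m. monomial (pos_part m) - monomial (neg_part m)) ` L)"

definition graded_piece :: "int^'r^'d \<Rightarrow> int^'d \<Rightarrow> ('r, 'k::field) mpoly set" where
  "graded_piece beta \<alpha> = {f. \<forall>u\<in>Poly_Mapping.keys f. beta *v (\<chi> j. int (u $ j)) = \<alpha>}"


section \<open>Multigraded Hilbert polynomial and degree\<close>

text \<open>The residue classes of the (pairwise incongruent) elements of \<open>B\<close> form a \<open>'k\<close>-basis of
  \<open>(S/I)\<^sub>\<alpha>\<close>, where \<open>(S/I)\<^sub>\<alpha>\<close> is the image of \<open>S\<^sub>\<alpha>\<close> in \<open>S/I\<close>.\<close>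

definition quotient_basis ::
    "int^'r^'d \<Rightarrow> ('r, 'k::field) mpoly set \<Rightarrow> int^'d \<Rightarrow> ('r, 'k) mpoly set \<Rightarrow> bool" where
  "quotient_basis beta I \<alpha> B \<longleftrightarrow>
     finite B \<and> B \<subseteq> graded_piece beta \<alpha> \<and>
     (\<forall>c :: ('r, 'k) mpoly \<Rightarrow> 'k. (\<Sum>b\<in>B. const_poly (c b) * b) \<in> I \<longrightarrow> (\<forall>b\<in>B. c b = 0)) \<and>
     (\<forall>f\<in>graded_piece beta \<alpha>. \<exists>c :: ('r, 'k) mpoly \<Rightarrow> 'k. f - (\<Sum>b\<in>B. const_poly (c b) * b) \<in> I)"

definition hilbert_function ::
    "int^'r^'d \<Rightarrow> ('r, 'k::field) mpoly set \<Rightarrow> int^'d \<Rightarrow> nat" where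
  "hilbert_function beta I \<alpha> = (THE h. \<exists>B. quotient_basis beta I \<alpha> B \<and> card B = h)"

definition is_hilbert_polynomial ::
    "(real^'n) set set \<Rightarrow> int^'n^'r \<Rightarrow> int^'r^'d \<Rightarrow> ('r, 'k::field) mpoly set \<Rightarrow> ('d, rat) mpoly \<Rightarrow> bool" where
  "is_hilbert_polynomial \<Sigma> phi beta I p \<longleftrightarrow>
     (\<exists>a. \<forall>\<kappa>\<in>nef_degrees \<Sigma> phi beta.
        (\<exists>B. quotient_basis beta I (a + \<kappa>) B) \<and>
        eval_poly p (a + \<kappa>) = of_nat (hilbert_function beta I (a + \<kappa>)))"

definition hilbert_polynomial ::
    "(real^'n) set set \<Rightarrow> int^'n^'r \<Rightarrow> int^'r^'d \<Rightarrow> ('r, 'k::field) mpoly set \<Rightarrow> ('d, rat) mpoly" where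
  "hilbert_polynomial \<Sigma> phi beta I = (THE p. is_hilbert_polynomial \<Sigma> phi beta I p)"

text \<open>Meaningful only if the Hilbert polynomial of \<open>S/I\<close> is constant.\<close>

definition ideal_degree ::
    "(real^'n) set set \<Rightarrow> int^'n^'r \<Rightarrow> int^'r^'d \<Rightarrow> ('r, 'k::field) mpoly set \<Rightarrow> rat" where
  "ideal_degree \<Sigma> phi beta I = (THE c. hilbert_polynomial \<Sigma> phi beta I = const_poly c)"


section \<open>Newton polytopes and mixed volume\<close>

definition newton_polytope :: "('r::finite, 'k::field) mpoly \<Rightarrow> (real^'r) set" where
  "newton_polytope f = convex hull ((\<lambda>u. \<chi> j. real (u $ j)) ` Poly_Mapping.keys f)"

text \<open>\<open>Q\<close> is the polytope \<open>P\<close>, up to translation, in the coordinates given by \<open>phi\<close>.\<close>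

definition identified_via :: "int^'n^'r \<Rightarrow> (real^'r) set \<Rightarrow> (real^'n) set \<Rightarrow> bool" where
  "identified_via phi P Q \<longleftrightarrow> (\<exists>w. P = (\<lambda>x. w + map_matrix real_of_int phi *v x) ` Q)"

text \<open>The mixed volume, as a function of lists of \<open>n\<close> nonempty polytopes in \<open>\<real>\<^sup>n\<close> (other lists are
  irrelevant). The empty set, which is a \<^const>\<open>polytope\<close>, must be excluded: it
  absorbs Minkowski sums, so no multilinear function could be defined on it.\<close>

definition nonempty_polytope :: "(real^'n) set \<Rightarrow> bool" where
  "nonempty_polytope P \<longleftrightarrow> polytope P \<and> P \<noteq> {}"

definition minkowski_comb :: "real \<Rightarrow> (real^'n) set \<Rightarrow> real \<Rightarrow> (real^'n) set \<Rightarrow> (real^'n) set" where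
  "minkowski_comb s P t Q = {s *\<^sub>R x + t *\<^sub>R y | x y. x \<in> P \<and> y \<in> Q}"

definition is_mixed_volume :: "((real^'n) set list \<Rightarrow> real) \<Rightarrow> bool" where
  "is_mixed_volume V \<longleftrightarrow>
     (\<forall>Ps Qs. length Ps = CARD('n) \<and> list_all nonempty_polytope Ps \<and> mset Qs = mset Ps
        \<longrightarrow> V Qs = V Ps) \<and>
     (\<forall>Ps i P Q s t. length Ps = CARD('n) \<and> list_all nonempty_polytope Ps \<and> i < CARD('n) \<and>
        nonempty_polytope P \<and> nonempty_polytope Q \<and> 0 \<le> s \<and> 0 \<le> t
        \<longrightarrow> V (Ps[i := minkowski_comb s P t Q]) = s * V (Ps[i := P]) + t * V (Ps[i := Q])) \<and>
     (\<forall>P. nonempty_polytope P \<longrightarrow> V (replicate CARD('n) P) = measure lebesgue P)"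

end

theory Submission
  imports Defs "HOL-Computational_Algebra.Polynomial"
begin

text \<open>
  Both sides are equal to the index \<open>d\<^sub>1 \<cdots> d\<^sub>n\<close> of \<open>L\<close> in \<open>L\<^sub>\<beta>\<close>.

  Modulo the lattice ideal two monomials agree as soon as their exponents differ by an element of
  \<open>L\<close>, and these are the only linear relations: replacing every exponent by a fixed representative of
  its coset is a linear map whose kernel is the ideal (\<open>in_lattice_ideal_iff\<close>). So the Hilbert function
  at \<open>\<alpha>\<close> counts the cosets of \<open>L\<close> that contain a nonnegative vector of the fibre \<open>\<beta> u = \<alpha>\<close>. The integer
  points of this fibre form one coset of \<open>L\<^sub>\<beta>\<close>, hence \<open>d\<^sub>1 \<cdots> d\<^sub>n\<close> cosets of \<open>L\<close>, and if some \<open>u\<close> in the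
  fibre has only large entries, then each of these cosets has a representative near \<open>u\<close>, which is
  nonnegative (\<open>card_cosets_in_fibre\<close>). Nef degrees have a nonnegative preimage under \<open>\<beta>\<close>, so every
  degree in a suitable translate of the nef semigroup has such a \<open>u\<close>, and the constant
  \<open>d\<^sub>1 \<cdots> d\<^sub>n\<close> is a Hilbert polynomial.

  It is the only one because the nef semigroup is Zariski dense: it contains an ample class \<open>\<kappa>\<close>, and
  for every degree \<open>e\<close> the classes \<open>M \<kappa> + e\<close> with \<open>M\<close> large are nef (\<open>nef_degrees_absorbing\<close>), so the
  semigroup contains boxes of any size, and a polynomial is determined by its values on a large box
  (\<open>eval_poly_determined_by_box\<close>). This is where projectivity and smoothness of the fan enter.

  On the other side, \<open>P\<^sub>i\<close> is a translate of the segment from \<open>0\<close> to \<open>d\<^sub>i w\<^sub>i\<close>, where \<open>w\<^sub>1, \<dots>, w\<^sub>n\<close> is the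
  basis of \<open>\<int>\<^sup>n\<close> that corresponds to \<open>m\<^sub>1, \<dots>, m\<^sub>n\<close>. Expanding the volume of the Minkowski sum
  of all segments by multilinearity, only the terms with every segment occurring once survive, because a
  sum over fewer segments is flat (\<open>mixed_volume_eq_measure_sum\<close>). There are \<open>n!\<close> such
  terms, all equal, so \<open>n! V(P\<^sub>1, \<dots>, P\<^sub>n)\<close> is the volume of the parallelepiped spanned by the vectors
  \<open>d\<^sub>i w\<^sub>i\<close>, which is \<open>d\<^sub>1 \<cdots> d\<^sub>n\<close> since the \<open>w\<^sub>i\<close> have determinant \<open>\<plusminus>1\<close>.
\<close>

section \<open>Normal forms modulo a lattice ideal\<close>

interpretation poly_ideal: module "(*) :: ('i::finite, 'k::field) mpoly \<Rightarrow> _ \<Rightarrow> _"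
  by unfold_locales (simp_all add: algebra_simps)

(* With multiplication as the scalar action this rule reassociates products,
   which makes the simplifier loop. *)
declare poly_ideal.scale_scale [simp del]

lemma const_poly_simps:
  "const_poly 0 = 0" "const_poly 1 = 1"
  "const_poly (a + b) = const_poly a + const_poly b"
  "const_poly (a * b) = const_poly a * const_poly b"
  "const_poly (- a) = - const_poly a"
  by (simp_all add: const_poly_def single_add mult_single single_uminus)

interpretation poly_space: vector_space "\<lambda>c (f :: ('i::finite, 'k::field) mpoly). const_poly c * f"
  by unfold_locales (simp_all add: const_poly_simps algebra_simps)

lemma const_times_monomial:
  "const_poly c * monomial u = Poly_Mapping.single u (c :: 'k::field)"
  by (simp add: const_poly_def monomial_def mult_single)

lemma poly_eq_sum_terms:
  fixes f :: "('i::finite, 'k::field) mpoly"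
  assumes "finite A" "Poly_Mapping.keys f \<subseteq> A"
  shows "f = (\<Sum>u\<in>A. Poly_Mapping.single u (Poly_Mapping.lookup f u))"
proof (rule poly_mapping_eqI)
  fix k
  have "(\<Sum>u\<in>A. Poly_Mapping.lookup (Poly_Mapping.single u (Poly_Mapping.lookup f u)) k)
      = (\<Sum>u\<in>A. if u = k then Poly_Mapping.lookup f k else 0)"
    by (rule sum.cong) (auto simp: lookup_single when_def)
  also have "\<dots> = Poly_Mapping.lookup f k"
    using assms by (auto simp: in_keys_iff)
  finally show "Poly_Mapping.lookup f k =
      Poly_Mapping.lookup (\<Sum>u\<in>A. Poly_Mapping.single u (Poly_Mapping.lookup f u)) k"
    by (simp add: lookup_sum)
qed

definition int_exponent :: "nat^'i \<Rightarrow> int^'i" where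
  "int_exponent u = (\<chi> j. int (u $ j))"

lemma int_exponent_add: "int_exponent (u + v) = int_exponent u + int_exponent v"
  by (simp add: int_exponent_def vec_eq_iff)

locale exponent_lattice =
  fixes L :: "(int^'i::finite) set"
  assumes zero_in: "0 \<in> L"
    and diff_in: "x \<in> L \<Longrightarrow> y \<in> L \<Longrightarrow> x - y \<in> L"
begin

lemma minus_in: "x \<in> L \<Longrightarrow> - x \<in> L"
  using diff_in[OF zero_in] by force

lemma add_in: "x \<in> L \<Longrightarrow> y \<in> L \<Longrightarrow> x + y \<in> L"
  using diff_in[of x "- y"] minus_in by simp

text \<open>The coset representative is chosen in \<open>\<nat>\<^sup>r\<close>, so that it is again the exponent of a monomial.\<close>

definition rep :: "nat^'i \<Rightarrow> nat^'i" where
  "rep u = (SOME v. int_exponent u - int_exponent v \<in> L)"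

lemma rep_cong: "int_exponent u - int_exponent (rep u) \<in> L"
  unfolding rep_def by (rule someI[of _ u]) (simp add: zero_in)

lemma rep_eq_iff: "rep u = rep v \<longleftrightarrow> int_exponent u - int_exponent v \<in> L"
proof
  assume "rep u = rep v"
  then have "(int_exponent u - int_exponent (rep u)) - (int_exponent v - int_exponent (rep u)) \<in> L"
    by (metis diff_in rep_cong)
  then show "int_exponent u - int_exponent v \<in> L" by simp
next
  assume *: "int_exponent u - int_exponent v \<in> L"
  have "int_exponent u - int_exponent w \<in> L \<longleftrightarrow> int_exponent v - int_exponent w \<in> L" for w
    using diff_in[OF _ *, of "int_exponent u - int_exponent w"]
      add_in[OF *, of "int_exponent v - int_exponent w"] by auto
  then show "rep u = rep v" unfolding rep_def by simp
qed

lemma rep_rep [simp]: "rep (rep u) = rep u"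
  using minus_in[OF rep_cong[of u]] by (simp add: rep_eq_iff)

lemma rep_add_rep: "rep (v + rep u) = rep (v + u)"
  using minus_in[OF rep_cong[of u]] by (simp add: rep_eq_iff int_exponent_add)

text \<open>The linear projection that sends each monomial to the chosen monomial of its coset.\<close>

definition normal_form :: "('i, 'k::field) mpoly \<Rightarrow> ('i, 'k) mpoly" where
  "normal_form f = (\<Sum>u\<in>Poly_Mapping.keys f. Poly_Mapping.single (rep u) (Poly_Mapping.lookup f u))"

lemma normal_form_superset:
  assumes "finite A" "Poly_Mapping.keys f \<subseteq> A"
  shows "normal_form f = (\<Sum>u\<in>A. Poly_Mapping.single (rep u) (Poly_Mapping.lookup f u))"
  unfolding normal_form_def using assms
  by (intro sum.mono_neutral_left) (auto simp: in_keys_iff)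

lemma normal_form_single [simp]:
  "normal_form (Poly_Mapping.single u c) = Poly_Mapping.single (rep u) c"
  by (subst normal_form_superset[of "{u}"]) (auto split: if_splits)

lemma normal_form_zero [simp]: "normal_form 0 = 0"
  by (simp add: normal_form_def)

lemma normal_form_add: "normal_form (f + g) = normal_form f + normal_form g"
proof -
  let ?A = "Poly_Mapping.keys f \<union> Poly_Mapping.keys g"
  have "Poly_Mapping.keys (f + g) \<subseteq> ?A" by (rule keys_add)
  then show ?thesis
    by (simp add: normal_form_superset[of ?A] lookup_add single_add sum.distrib)
qed

lemma normal_form_sum: "normal_form (\<Sum>x\<in>X. f x) = (\<Sum>x\<in>X. normal_form (f x))"
  by (induction X rule: infinite_finite_induct) (simp_all add: normal_form_add)

text \<open>Translation permutes the cosets, so multiplication by a term is compatible with normal forms; this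
  makes the kernel of \<open>normal_form\<close> closed under multiplication.\<close>

lemma normal_form_times_term:
  "normal_form (Poly_Mapping.single v c * f) = normal_form (Poly_Mapping.single v c * normal_form f)"
proof -
  let ?K = "Poly_Mapping.keys f"
  have "Poly_Mapping.single v c * f =
      (\<Sum>u\<in>?K. Poly_Mapping.single (v + u) (c * Poly_Mapping.lookup f u))"
    by (subst poly_eq_sum_terms[of ?K f]) (simp_all add: sum_distrib_left mult_single)
  then show ?thesis
    by (simp add: normal_form_def[of f] sum_distrib_left mult_single normal_form_sum rep_add_rep)
qed

lemma normal_form_times: "normal_form (g * f) = normal_form (g * normal_form f)"
proof -
  have *: "g * h = (\<Sum>v\<in>Poly_Mapping.keys g. Poly_Mapping.single v (Poly_Mapping.lookup g v) * h)" for h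
    by (subst poly_eq_sum_terms[of "Poly_Mapping.keys g" g]) (simp_all add: sum_distrib_right)
  show ?thesis
    unfolding *[of f] *[of "normal_form f"] normal_form_sum
    by (rule sum.cong[OF refl]) (rule normal_form_times_term)
qed

lemma normal_form_scale: "normal_form (const_poly c * f) = const_poly c * normal_form f"
proof -
  have "normal_form (const_poly c * f) = (\<Sum>u\<in>Poly_Mapping.keys f.
       normal_form (Poly_Mapping.single 0 c * Poly_Mapping.single u (Poly_Mapping.lookup f u)))"
    by (subst poly_eq_sum_terms[of "Poly_Mapping.keys f" f])
      (simp_all add: sum_distrib_left normal_form_sum const_poly_def)
  also have "\<dots> = const_poly c * normal_form f"
    unfolding mult_single normal_form_single
    by (simp add: mult_single normal_form_def sum_distrib_left const_poly_def)
  finally show ?thesis .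
qed

lemma normal_form_diff: "normal_form (f - g) = normal_form f - normal_form g"
proof -
  have "normal_form (- g) = - normal_form g"
    using normal_form_scale[of "- 1" g] by (simp add: const_poly_simps)
  then show ?thesis using normal_form_add[of f "- g"] by simp
qed

text \<open>Dividing both monomials by their greatest common divisor leaves the positive and the negative part of
  the difference as exponents, that is, a generator of the ideal.\<close>

lemma binomial_in_ideal:
  assumes "int_exponent u - int_exponent v \<in> L"
  shows "(monomial u - monomial v :: ('i, 'k::field) mpoly) \<in> lattice_ideal L"
proof -
  let ?m = "int_exponent u - int_exponent v"
  define w :: "nat^'i" where "w = (\<chi> j. min (u $ j) (v $ j))"
  have u: "u = w + pos_part ?m" and v: "v = w + neg_part ?m"
    by (auto simp: w_def pos_part_def neg_part_def int_exponent_def vec_eq_iff)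
  have "(monomial (pos_part ?m) - monomial (neg_part ?m) :: ('i, 'k) mpoly) \<in> lattice_ideal L"
    unfolding lattice_ideal_def ideal_generated_def
    by (rule poly_ideal.span_base) (use assms in blast)
  then have "monomial w * (monomial (pos_part ?m) - monomial (neg_part ?m) :: ('i, 'k) mpoly)
      \<in> lattice_ideal L"
    unfolding lattice_ideal_def ideal_generated_def by (rule poly_ideal.span_scale)
  also have "monomial w * (monomial (pos_part ?m) - monomial (neg_part ?m) :: ('i, 'k) mpoly)
      = monomial u - monomial v"
    by (subst (2) u, subst (2) v) (simp add: monomial_def mult_single algebra_simps)
  finally show ?thesis .
qed

lemma diff_normal_form_in_ideal:
  fixes f :: "('i, 'k::field) mpoly"
  shows "f - normal_form f \<in> lattice_ideal L"
proof -
  have "f - normal_form f = (\<Sum>u\<in>Poly_Mapping.keys f.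
      const_poly (Poly_Mapping.lookup f u) * (monomial u - monomial (rep u)))"
    by (subst (1) poly_eq_sum_terms[of "Poly_Mapping.keys f" f])
      (simp_all add: normal_form_def right_diff_distrib const_times_monomial sum_subtractf)
  also have "\<dots> \<in> lattice_ideal L"
    unfolding lattice_ideal_def ideal_generated_def
    by (intro poly_ideal.span_sum poly_ideal.span_scale)
      (use binomial_in_ideal[OF rep_cong] in \<open>simp add: lattice_ideal_def ideal_generated_def\<close>)
  finally show ?thesis .
qed

text \<open>The kernel of \<open>normal_form\<close> is an ideal that contains the generators, and conversely a polynomial is
  congruent to its normal form.\<close>

lemma in_lattice_ideal_iff:
  fixes f :: "('i, 'k::field) mpoly"
  shows "f \<in> lattice_ideal L \<longleftrightarrow> normal_form f = 0"
proof
  assume "f \<in> lattice_ideal L"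
  then show "normal_form f = 0"
    unfolding lattice_ideal_def ideal_generated_def
  proof (induction rule: poly_ideal.span_induct_alt)
    case base
    then show ?case by simp
  next
    case (step g f h)
    from step.hyps obtain m where m: "m \<in> L" "f = monomial (pos_part m) - monomial (neg_part m)"
      by blast
    have "int_exponent (pos_part m) - int_exponent (neg_part m) = m"
      by (simp add: int_exponent_def pos_part_def neg_part_def vec_eq_iff)
    then have "normal_form f = 0"
      using m rep_eq_iff[of "pos_part m" "neg_part m"] by (simp add: normal_form_diff monomial_def)
    then show ?case
      using step.IH by (simp add: normal_form_add normal_form_times[of g])
  qed
next
  assume "normal_form f = 0"
  then show "f \<in> lattice_ideal L" using diff_normal_form_in_ideal[of f] by simp
qed

subsection \<open>Monomial bases of the graded pieces\<close>

lemma lookup_const_monomial_sum: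
  assumes "finite A" "u \<in> A"
  shows "Poly_Mapping.lookup (\<Sum>v\<in>A. const_poly (c v :: 'k::field) * monomial v) u = c u"
proof -
  have "Poly_Mapping.lookup (\<Sum>v\<in>A. const_poly (c v) * monomial v) u = (\<Sum>v\<in>A. if v = u then c u else 0)"
    unfolding lookup_sum by (rule sum.cong) (auto simp: const_times_monomial lookup_single when_def)
  then show ?thesis using assms by simp
qed

lemma inj_monomial: "inj (monomial :: nat^'i \<Rightarrow> ('i, 'k::field) mpoly)"
  unfolding monomial_def by (rule injI) (metis keys_single singleton_inject zero_neq_one)

lemma independent_monomials:
  assumes "finite A"
  shows "poly_space.independent (monomial ` A :: ('i, 'k::field) mpoly set)"
proof (rule poly_space.independent_if_scalars_zero)
  fix g :: "('i, 'k) mpoly \<Rightarrow> 'k" and x :: "('i, 'k) mpoly"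
  assume 0: "(\<Sum>x\<in>monomial ` A. const_poly (g x) * x) = 0" and x: "x \<in> monomial ` A"
  then obtain u where u: "x = monomial u" "u \<in> A" by auto
  have "(\<Sum>v\<in>A. const_poly (g (monomial v)) * monomial v) = 0"
    using 0 by (subst (asm) sum.reindex) (auto intro: inj_on_subset[OF inj_monomial])
  then have "Poly_Mapping.lookup (\<Sum>v\<in>A. const_poly (g (monomial v)) * monomial v) u = 0"
    by simp
  then show "g x = 0" using assms u lookup_const_monomial_sum[of A u "\<lambda>v. g (monomial v)"] by simp
next
  show "finite (monomial ` A :: ('i, 'k) mpoly set)" using assms by (rule finite_imageI)
qed

definition fibre :: "int^'i^'d::finite \<Rightarrow> int^'d \<Rightarrow> (nat^'i) set" where
  "fibre beta \<alpha> = {u. beta *v int_exponent u = \<alpha>}"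

lemma normal_form_in_span:
  fixes f :: "('i, 'k::field) mpoly"
  assumes "f \<in> graded_piece beta \<alpha>"
  shows "normal_form f \<in> poly_space.span (monomial ` rep ` fibre beta \<alpha>)"
proof -
  have "Poly_Mapping.single (rep u) (Poly_Mapping.lookup f u)
      \<in> poly_space.span (monomial ` rep ` fibre beta \<alpha>)" if "u \<in> Poly_Mapping.keys f" for u
  proof -
    have "u \<in> fibre beta \<alpha>"
      using assms that by (simp add: graded_piece_def fibre_def int_exponent_def)
    then have "monomial (rep u) \<in> (monomial ` rep ` fibre beta \<alpha> :: ('i, 'k) mpoly set)"
      by blast
    from poly_space.span_scale[OF poly_space.span_base[OF this]] show ?thesis
      by (simp only: const_times_monomial)
  qed
  then show ?thesis unfolding normal_form_def by (rule poly_space.span_sum)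
qed

text \<open>Normal forms of degree \<open>\<alpha>\<close> are the combinations of the representative monomials, and these are
  fixed by \<open>normal_form\<close>, hence independent modulo its kernel.\<close>

lemma quotient_basis_monomials:
  assumes fin: "finite (rep ` fibre beta \<alpha>)" and L: "L \<subseteq> {x. beta *v x = 0}"
  shows "quotient_basis beta (lattice_ideal L :: ('i, 'k::field) mpoly set) \<alpha>
    (monomial ` rep ` fibre beta \<alpha>)" (is "quotient_basis beta ?I \<alpha> ?B")
  unfolding quotient_basis_def
proof (intro conjI allI impI ballI)
  show "finite ?B" using fin by simp
  have "rep u \<in> fibre beta \<alpha>" if "u \<in> fibre beta \<alpha>" for u
    using L rep_cong[of u] that by (auto simp: fibre_def matrix_vector_mult_diff_distrib)
  then show "?B \<subseteq> graded_piece beta \<alpha>"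
    by (force simp: graded_piece_def monomial_def fibre_def int_exponent_def)
next
  fix c :: "('i, 'k) mpoly \<Rightarrow> 'k" and b
  assume "(\<Sum>b\<in>?B. const_poly (c b) * b) \<in> ?I" and b: "b \<in> ?B"
  then have "(\<Sum>b\<in>?B. const_poly (c b) * normal_form b) = 0"
    by (simp only: in_lattice_ideal_iff normal_form_sum normal_form_scale)
  also have "(\<Sum>b\<in>?B. const_poly (c b) * normal_form b) = (\<Sum>b\<in>?B. const_poly (c b) * b)"
    by (rule sum.cong) (auto simp: monomial_def)
  finally show "c b = 0"
    using poly_space.independentD[OF independent_monomials[OF fin] _ subset_refl] fin b by blast
next
  fix f :: "('i, 'k) mpoly" assume f: "f \<in> graded_piece beta \<alpha>"
  obtain c where c: "normal_form f = (\<Sum>b\<in>?B. const_poly (c b) * b)"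
    using normal_form_in_span[OF f] fin by (auto simp: poly_space.span_finite)
  show "\<exists>c. f - (\<Sum>b\<in>?B. const_poly (c b) * b) \<in> ?I"
    by (rule exI[of _ c]) (use diff_normal_form_in_ideal[of f] in \<open>simp only: c\<close>)
qed

text \<open>The Hilbert function is a definite description, so it is well defined only once all bases of the graded
  piece are known to have the same size. The map \<open>normal_form\<close> identifies the graded piece of the
  quotient with the span of the representative monomials, where Steinitz exchange applies.\<close>

lemma card_quotient_basis:
  fixes B :: "('i, 'k::field) mpoly set"
  assumes fin: "finite (rep ` fibre beta \<alpha>)" and L: "L \<subseteq> {x. beta *v x = 0}"
    and B: "quotient_basis beta (lattice_ideal L) \<alpha> B"
  shows "card B = card (rep ` fibre beta \<alpha>)"
proof -
  let ?M = "monomial ` rep ` fibre beta \<alpha> :: ('i, 'k) mpoly set"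
  from B have finB: "finite B" and deg: "B \<subseteq> graded_piece beta \<alpha>"
    and ind: "\<And>c. (\<Sum>b\<in>B. const_poly (c b) * b) \<in> lattice_ideal L \<Longrightarrow> (\<forall>b\<in>B. c b = 0)"
    and gen: "\<And>f. f \<in> graded_piece beta \<alpha> \<Longrightarrow>
         \<exists>c. f - (\<Sum>b\<in>B. const_poly (c b) * b) \<in> lattice_ideal L"
    unfolding quotient_basis_def by auto
  have zero: "\<forall>b\<in>B. c b = 0" if "(\<Sum>b\<in>B. const_poly (c b) * normal_form b) = 0" for c
    using that by (intro ind) (simp add: in_lattice_ideal_iff normal_form_sum normal_form_scale)
  have inj: "inj_on normal_form B"
  proof (rule inj_onI, rule ccontr)
    fix x y assume xy: "x \<in> B" "y \<in> B" "normal_form x = normal_form y" "x \<noteq> y"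
    define c :: "('i, 'k) mpoly \<Rightarrow> 'k" where "c = (\<lambda>b. if b = x then 1 else if b = y then - 1 else 0)"
    have "(\<Sum>b\<in>B. const_poly (c b) * normal_form b) =
        (\<Sum>b\<in>{x, y}. const_poly (c b) * normal_form b)"
      using finB xy by (intro sum.mono_neutral_right) (auto simp: c_def const_poly_simps)
    also have "\<dots> = 0" using xy by (simp add: c_def const_poly_simps)
    finally show False using zero[of c] xy by (auto simp: c_def)
  qed
  have "poly_space.independent (normal_form ` B)"
  proof (rule poly_space.independent_if_scalars_zero)
    fix g :: "('i, 'k) mpoly \<Rightarrow> 'k" and x
    assume "(\<Sum>x\<in>normal_form ` B. const_poly (g x) * x) = 0" "x \<in> normal_form ` B"
    then show "g x = 0" using zero[of "g \<circ> normal_form"] by (auto simp: sum.reindex[OF inj])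
  qed (use finB in auto)
  moreover have "normal_form ` B \<subseteq> poly_space.span ?M"
    using normal_form_in_span deg by blast
  ultimately have "card (normal_form ` B) \<le> card ?M"
    using poly_space.independent_span_bound[of ?M] fin by blast
  moreover have "?M \<subseteq> poly_space.span (normal_form ` B)"
  proof
    fix f assume f: "f \<in> ?M"
    then have "f \<in> graded_piece beta \<alpha>"
      using quotient_basis_monomials[OF fin L, where 'k='k] unfolding quotient_basis_def by blast
    from gen[OF this] obtain c where "normal_form (f - (\<Sum>b\<in>B. const_poly (c b) * b)) = 0"
      by (auto simp: in_lattice_ideal_iff)
    moreover have "normal_form f = f" using f by (auto simp: monomial_def)
    ultimately have "f = (\<Sum>b\<in>B. const_poly (c b) * normal_form b)"
      by (simp add: normal_form_diff normal_form_sum normal_form_scale)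
    moreover have "(\<Sum>b\<in>B. const_poly (c b) * normal_form b) \<in> poly_space.span (normal_form ` B)"
      by (intro poly_space.span_sum poly_space.span_scale poly_space.span_base imageI)
    ultimately show "f \<in> poly_space.span (normal_form ` B)" by (rule ssubst)
  qed
  then have "card ?M \<le> card (normal_form ` B)"
    using poly_space.independent_span_bound[of "normal_form ` B" ?M]
      independent_monomials[OF fin, where 'k='k] finB by blast
  ultimately have "card (normal_form ` B) = card ?M" by simp
  then show ?thesis
    by (simp only: card_image[OF inj] card_image[OF inj_on_subset[OF inj_monomial subset_UNIV]])
qed

lemma hilbert_function_lattice_ideal:
  assumes fin: "finite (rep ` fibre beta \<alpha>)" and L: "L \<subseteq> {x. beta *v x = 0}"
  shows "hilbert_function beta (lattice_ideal L :: ('i, 'k::field) mpoly set) \<alpha>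
    = card (rep ` fibre beta \<alpha>)"
  unfolding hilbert_function_def
proof (rule the_equality)
  have *: "quotient_basis beta (lattice_ideal L :: ('i, 'k) mpoly set) \<alpha>
      (monomial ` rep ` fibre beta \<alpha>)"
    by (rule quotient_basis_monomials[OF fin L])
  show "\<exists>B. quotient_basis beta (lattice_ideal L :: ('i, 'k) mpoly set) \<alpha> B
      \<and> card B = card (rep ` fibre beta \<alpha>)"
    by (rule exI, rule conjI, rule *, rule card_quotient_basis[OF fin L *])
next
  fix h assume "\<exists>B. quotient_basis beta (lattice_ideal L :: ('i, 'k) mpoly set) \<alpha> B \<and> card B = h"
  then obtain B :: "('i, 'k) mpoly set"
    where B: "quotient_basis beta (lattice_ideal L) \<alpha> B" "card B = h" by (elim exE conjE)
  show "h = card (rep ` fibre beta \<alpha>)"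
    using card_quotient_basis[OF fin L B(1)] B(2) by (simp only:)
qed

end

section \<open>Polynomials vanishing on a box\<close>


text \<open>Induction on the set \<open>J\<close> of variables: with the other coordinates fixed, the sum is a polynomial in the
  variable \<open>k\<close> with more roots than its degree, so each of its coefficients vanishes, and these
  are sums of the same kind in the remaining variables. The exponent vectors in \<open>E\<close> agree outside
  \<open>J\<close> in order that distinct exponents stay distinct when they are restricted to \<open>J\<close>.\<close>

lemma coefficients_zero_if_vanishing_on_box:
  fixes c :: "('i \<Rightarrow> nat) \<Rightarrow> rat" and A :: "'i \<Rightarrow> rat set"
  assumes "finite J" and "finite E"
    and "\<And>e e' j. e \<in> E \<Longrightarrow> e' \<in> E \<Longrightarrow> j \<notin> J \<Longrightarrow> e j = e' j"
    and "\<And>e j. e \<in> E \<Longrightarrow> j \<in> J \<Longrightarrow> e j < card (A j)"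
    and "\<And>x. (\<forall>j\<in>J. x j \<in> A j) \<Longrightarrow> (\<Sum>e\<in>E. c e * (\<Prod>j\<in>J. x j ^ e j)) = 0"
    and "e \<in> E"
  shows "c e = 0"
  using assms
proof (induction J arbitrary: E e rule: finite_induct)
  case empty
  have "E = {e}" using empty.prems(2,5) by (auto simp: fun_eq_iff)
  then show ?case using empty.prems(4)[of undefined] by simp
next
  case (insert k J)
  define F where "F = (\<lambda>i. {f \<in> E. f k = i})"
  have fib: "(\<Sum>f\<in>F i. c f * (\<Prod>j\<in>J. x j ^ f j)) = 0"
    if x: "\<forall>j\<in>J. x j \<in> A j" for x i
  proof (cases "F i = {}")
    case False
    define g where "g = (\<lambda>i. \<Sum>f\<in>F i. c f * (\<Prod>j\<in>J. x j ^ f j))"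
    define p where "p = (\<Sum>i<card (A k). monom (g i) i)"
    have "poly p t = 0" if t: "t \<in> A k" for t
    proof -
      have "0 = (\<Sum>f\<in>E. c f * (\<Prod>j\<in>insert k J. (x(k := t)) j ^ f j))"
        by (rule insert.prems(4)[symmetric]) (use x t insert.hyps in auto)
      also have "\<dots> = (\<Sum>f\<in>E. c f * (\<Prod>j\<in>J. x j ^ f j) * t ^ f k)"
      proof (rule sum.cong[OF refl])
        fix f
        have "(\<Prod>j\<in>J. (x(k := t)) j ^ f j) = (\<Prod>j\<in>J. x j ^ f j)"
          by (rule prod.cong) (use insert.hyps in auto)
        then show "c f * (\<Prod>j\<in>insert k J. (x(k := t)) j ^ f j) = c f * (\<Prod>j\<in>J. x j ^ f j) * t ^ f k"
          using insert.hyps by (simp add: mult_ac)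
      qed
      also have "\<dots> = (\<Sum>i<card (A k). \<Sum>f\<in>F i. c f * (\<Prod>j\<in>J. x j ^ f j) * t ^ f k)"
        unfolding F_def using insert.prems(1,3)
        by (intro sum.group[symmetric]) auto
      also have "\<dots> = poly p t"
        unfolding p_def g_def poly_sum poly_monom sum_distrib_right
        by (intro sum.cong refl) (auto simp: F_def)
      finally show ?thesis by simp
    qed
    then have sub: "A k \<subseteq> {t. poly p t = 0}" by auto
    have pos: "0 < card (A k)" using insert.prems(3,5) by fastforce
    have "degree p < card (A k)"
      unfolding p_def by (rule degree_sum_less[OF _ pos]) (auto intro: le_less_trans[OF degree_monom_le])
    then have "p = 0"
      using card_poly_roots_bound[of p] card_mono[OF poly_roots_finite sub] by force
    moreover have "i < card (A k)" using False insert.prems(3) by (auto simp: F_def)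
    then have "coeff p i = g i"
      by (simp add: p_def coeff_sum if_distrib sum.delta cong: if_cong)
    ultimately show ?thesis by (simp add: g_def)
  qed simp
  show ?case
  proof (rule insert.IH[of "F (e k)"])
    fix f f' j assume f: "f \<in> F (e k)" "f' \<in> F (e k)" "j \<notin> J"
    then show "f j = f' j"
      using insert.prems(2)[of f f' j] by (cases "j = k") (auto simp: F_def)
  qed (use insert.prems fib in \<open>auto simp: F_def\<close>)
qed

lemma eval_poly_determined_by_box:
  fixes p q :: "('i::finite, rat) mpoly"
  assumes "\<And>e j. e \<in> Poly_Mapping.keys p \<union> Poly_Mapping.keys q \<Longrightarrow> e $ j \<le> D"
    and "\<And>z :: int^'i. (\<And>j. 0 \<le> z $ j \<and> z $ j \<le> int D) \<Longrightarrow> eval_poly p (b + z) = eval_poly q (b + z)"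
  shows "p = q"
proof (rule poly_mapping_eqI)
  let ?K = "Poly_Mapping.keys p \<union> Poly_Mapping.keys q"
  define c where "c e = Poly_Mapping.lookup p (vec_lambda e) - Poly_Mapping.lookup q (vec_lambda e)" for e
  have inj: "inj_on vec_nth ?K" by (rule inj_onI) (simp add: vec_eq_iff)
  have ev: "eval_poly r a = (\<Sum>e\<in>?K. Poly_Mapping.lookup r e * (\<Prod>j\<in>UNIV. of_int (a $ j) ^ (e $ j)))"
    if "Poly_Mapping.keys r \<subseteq> ?K" for r a
    unfolding eval_poly_def using that
    by (intro sum.mono_neutral_left) (auto simp: in_keys_iff)
  fix e :: "nat^'i"
  show "Poly_Mapping.lookup p e = Poly_Mapping.lookup q e"
  proof (cases "e \<in> ?K")
    case True
    have "c (vec_nth e) = 0"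
    proof (rule coefficients_zero_if_vanishing_on_box[where J=UNIV and E="vec_nth ` ?K" and
          A="\<lambda>j. of_int ` {b $ j .. b $ j + int D}"])
      fix f :: "'i \<Rightarrow> nat" and j assume "f \<in> vec_nth ` ?K"
      then show "f j < card (rat_of_int ` {b $ j .. b $ j + int D})"
        using assms(1) by (subst card_image) (auto simp: inj_on_def less_Suc_eq_le nat_add_distrib)
    next
      fix x :: "'i \<Rightarrow> rat" assume "\<forall>j\<in>UNIV. x j \<in> rat_of_int ` {b $ j .. b $ j + int D}"
      then have "\<exists>z. x j = of_int (b $ j + z) \<and> 0 \<le> z \<and> z \<le> int D" for j
      proof -
        obtain y where "x j = of_int y" "b $ j \<le> y" "y \<le> b $ j + int D"
          using \<open>\<forall>j\<in>UNIV. x j \<in> _\<close> by force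
        then show ?thesis by (intro exI[of _ "y - b $ j"]) simp
      qed
      then obtain z where z: "\<And>j. x j = of_int (b $ j + z j)" "\<And>j. 0 \<le> z j \<and> z j \<le> int D"
        by metis
      have "eval_poly p (b + (\<chi> j. z j)) = eval_poly q (b + (\<chi> j. z j))"
        by (rule assms(2)) (use z in auto)
      then show "(\<Sum>e\<in>vec_nth ` ?K. c e * (\<Prod>j\<in>UNIV. x j ^ e j)) = 0"
        by (simp add: ev sum.reindex[OF inj] c_def z(1) left_diff_distrib sum_subtractf)
    qed (use True in auto)
    then show ?thesis by (simp add: c_def)
  qed (simp add: in_keys_iff)
qed

section \<open>Lattice bases\<close>

lemma lattice_basis_unique:
  assumes "lattice_basis b k L" "(\<Sum>i=1..k. c i *s b i) = (\<Sum>i=1..k. c' i *s b i)" "i \<in> {1..k}"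
  shows "c i = c' i"
proof -
  have "(\<Sum>i=1..k. (c i - c' i) *s b i) = 0"
    using assms(2) by (simp add: vector_sub_rdistrib sum_subtractf)
  then have "c i - c' i = 0"
    using assms(1,3) unfolding lattice_basis_def by (auto dest: spec[of _ "\<lambda>i. c i - c' i"])
  then show ?thesis by simp
qed

lemma lattice_basis_nonzero:
  assumes "lattice_basis b k L" "i \<in> {1..k}"
  shows "b i \<noteq> 0"
proof
  assume "b i = 0"
  then have "(\<Sum>l=1..k. (if l = i then 1 else 0) *s b l) = (\<Sum>l=1..k. 0 *s b l)"
    by (intro sum.cong) auto
  from lattice_basis_unique[OF assms(1) this assms(2)] show False by simp
qed

lemma lattice_basisE:
  assumes "lattice_basis b k L" "x \<in> L"
  obtains c where "x = (\<Sum>i=1..k. c i *s b i)"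
  using assms unfolding lattice_basis_def by blast

lemma lattice_basis_comb_in: "lattice_basis b k L \<Longrightarrow> (\<Sum>i=1..k. c i *s b i) \<in> L"
  unfolding lattice_basis_def by blast

lemma exponent_lattice_if_basis:
  assumes "lattice_basis b k L"
  shows "exponent_lattice L"
proof
  show "0 \<in> L" using lattice_basis_comb_in[OF assms, of "\<lambda>_. 0"] by simp
  fix x y assume "x \<in> L" "y \<in> L"
  then obtain c c' where "x = (\<Sum>i=1..k. c i *s b i)" "y = (\<Sum>i=1..k. c' i *s b i)"
    using lattice_basisE[OF assms] by metis
  then show "x - y \<in> L"
    using lattice_basis_comb_in[OF assms, of "\<lambda>i. c i - c' i"]
    by (simp add: vector_sub_rdistrib sum_subtractf)
qed

text \<open>The diagonal description of \<open>L\<close> in a basis of \<open>M\<close>, which identifies \<open>M/L\<close> with a product of cyclic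
  groups of orders \<open>d i\<close>.\<close>

lemma comb_in_scaled_lattice_iff:
  assumes m: "lattice_basis m k M" and L: "lattice_basis (\<lambda>i. int (d i) *s m i) k L"
  shows "(\<Sum>i=1..k. c i *s m i) \<in> L \<longleftrightarrow> (\<forall>i\<in>{1..k}. int (d i) dvd c i)"
proof
  assume "(\<Sum>i=1..k. c i *s m i) \<in> L"
  then obtain e where "(\<Sum>i=1..k. c i *s m i) = (\<Sum>i=1..k. (e i * int (d i)) *s m i)"
    using lattice_basisE[OF L] by (metis (no_types, lifting) sum.cong vector_smult_assoc)
  from lattice_basis_unique[OF m this] show "\<forall>i\<in>{1..k}. int (d i) dvd c i" by simp
next
  assume *: "\<forall>i\<in>{1..k}. int (d i) dvd c i"
  have "(\<Sum>i=1..k. c i *s m i) = (\<Sum>i=1..k. (c i div int (d i)) *s (int (d i) *s m i))"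
    using * by (intro sum.cong) (auto simp: vector_smult_assoc)
  then show "(\<Sum>i=1..k. c i *s m i) \<in> L"
    using lattice_basis_comb_in[OF L, of "\<lambda>i. c i div int (d i)"] by simp
qed

section \<open>Counting cosets in a fibre\<close>

text \<open>The cosets of \<open>L\<close> in the fibre are those of the points \<open>u + \<Sum> c\<^sub>i m\<^sub>i\<close> with \<open>0 \<le> c\<^sub>i < d\<^sub>i\<close>. The lower bound
  on the entries of \<open>u\<close> makes all these points nonnegative, so that every coset is hit by a
  monomial.\<close>

lemma (in exponent_lattice) card_cosets_in_fibre:
  fixes beta :: "int^'i^'d::finite"
  assumes m: "lattice_basis m k {x. beta *v x = 0}"
    and L: "lattice_basis (\<lambda>i. int (d i) *s m i) k L"
    and pos: "\<And>i. i \<in> {1..k} \<Longrightarrow> 0 < d i"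
    and u: "beta *v int_exponent u = \<alpha>"
    and large: "\<And>j. (\<Sum>i=1..k. int (d i) * \<bar>m i $ j\<bar>) \<le> int (u $ j)"
  shows "finite (rep ` fibre beta \<alpha>)" and "card (rep ` fibre beta \<alpha>) = (\<Prod>i=1..k. d i)"
proof -
  let ?R = "\<Pi>\<^sub>E i\<in>{1..k}. {0..<int (d i)}"
  define v :: "(nat \<Rightarrow> int) \<Rightarrow> nat^'i"
    where "v c = (\<chi> j. nat (int (u $ j) + (\<Sum>i=1..k. c i * m i $ j)))" for c
  have v: "int_exponent (v c) = int_exponent u + (\<Sum>i=1..k. c i *s m i)" if c: "c \<in> ?R" for c
  proof -
    have "0 \<le> int (u $ j) + (\<Sum>i=1..k. c i * m i $ j)" for j
    proof -
      have "\<bar>\<Sum>i=1..k. c i * m i $ j\<bar> \<le> (\<Sum>i=1..k. int (d i) * \<bar>m i $ j\<bar>)"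
      proof (rule order_trans[OF sum_abs sum_mono])
        fix i assume "i \<in> {1..k}"
        then have "c i \<in> {0..<int (d i)}" using c by (auto simp: PiE_iff)
        then show "\<bar>c i * m i $ j\<bar> \<le> int (d i) * \<bar>m i $ j\<bar>"
          by (auto simp: abs_mult intro!: mult_right_mono)
      qed
      then show ?thesis using large[of j] by linarith
    qed
    then show ?thesis by (simp add: v_def int_exponent_def vec_eq_iff sum_component)
  qed
  have rep_v: "rep (v c) = rep (v c') \<longleftrightarrow> (\<forall>i\<in>{1..k}. int (d i) dvd c i - c' i)"
    if "c \<in> ?R" "c' \<in> ?R" for c c'
    using comb_in_scaled_lattice_iff[OF m L, of "\<lambda>i. c i - c' i"] that
    by (simp add: rep_eq_iff v vector_sub_rdistrib sum_subtractf)
  have inj: "inj_on (\<lambda>c. rep (v c)) ?R"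
  proof (rule inj_onI)
    fix c c' assume c: "c \<in> ?R" "c' \<in> ?R" and "rep (v c) = rep (v c')"
    then have dvd: "\<forall>i\<in>{1..k}. int (d i) dvd c i - c' i" by (simp add: rep_v)
    show "c = c'"
    proof (rule PiE_ext[OF c])
      fix i assume i: "i \<in> {1..k}"
      then have "c i \<in> {0..<int (d i)}" "c' i \<in> {0..<int (d i)}" using c by (auto simp: PiE_iff)
      moreover have "c i mod int (d i) = c' i mod int (d i)"
        using dvd i by (simp add: mod_eq_dvd_iff)
      ultimately show "c i = c' i" by simp
    qed
  qed
  have img: "(\<lambda>c. rep (v c)) ` ?R = rep ` fibre beta \<alpha>"
  proof (intro subset_antisym image_subsetI)
    fix c assume c: "c \<in> ?R"
    have "beta *v (\<Sum>i=1..k. c i *s m i) = 0"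
      using lattice_basis_comb_in[OF m] by blast
    then have "v c \<in> fibre beta \<alpha>"
      using u by (simp add: fibre_def v[OF c] matrix_vector_right_distrib)
    then show "rep (v c) \<in> rep ` fibre beta \<alpha>" by blast
  next
    fix t assume t: "t \<in> fibre beta \<alpha>"
    then have "int_exponent t - int_exponent u \<in> {x. beta *v x = 0}"
      using u by (simp add: fibre_def matrix_vector_mult_diff_distrib)
    then obtain e where e: "int_exponent t - int_exponent u = (\<Sum>i=1..k. e i *s m i)"
      by (rule lattice_basisE[OF m])
    define c where "c = (\<lambda>i\<in>{1..k}. e i mod int (d i))"
    have c: "c \<in> ?R" using pos by (auto simp: c_def)
    have "int_exponent t - int_exponent (v c) = (\<Sum>i=1..k. (e i - c i) *s m i)"
      using e by (simp add: v[OF c] vector_sub_rdistrib sum_subtractf algebra_simps)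
    also have "\<dots> \<in> L"
      by (subst comb_in_scaled_lattice_iff[OF m L]) (auto simp: c_def minus_mod_eq_mult_div)
    finally have "rep t = rep (v c)" by (simp add: rep_eq_iff)
    then show "rep t \<in> (\<lambda>c. rep (v c)) ` ?R" using c by blast
  qed
  have fin: "finite ?R" by (intro finite_PiE) auto
  show "finite (rep ` fibre beta \<alpha>)" using fin by (simp flip: img)
  show "card (rep ` fibre beta \<alpha>) = (\<Prod>i=1..k. d i)"
    using card_image[OF inj] unfolding img by (simp add: card_PiE)
qed

section \<open>Bases of the full lattice\<close>

text \<open>The rows of \<open>C\<close> are the coordinates of the standard basis vectors with respect to \<open>b\<close>. Substituting them
  into the standard expansion of \<open>b i\<close> and comparing coefficients shows that the columns are dual to \<open>b\<close>.\<close>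

lemma lattice_basis_dual:
  fixes b :: "nat \<Rightarrow> int^'n"
  assumes "lattice_basis b k UNIV"
  obtains C :: "'n \<Rightarrow> nat \<Rightarrow> int"
  where "\<And>i j. i \<in> {1..k} \<Longrightarrow> j \<in> {1..k} \<Longrightarrow> (\<Sum>l\<in>UNIV. b i $ l * C l j) = (if i = j then 1 else 0)"
proof -
  have "\<exists>c. axis l 1 = (\<Sum>j=1..k. c j *s b j)" for l
    using lattice_basisE[OF assms UNIV_I, of "axis l 1"] by metis
  then obtain C where C: "\<And>l. axis l 1 = (\<Sum>j=1..k. C l j *s b j)" by metis
  have "(\<Sum>l\<in>UNIV. b i $ l * C l j) = (if i = j then 1 else 0)"
    if ij: "i \<in> {1..k}" "j \<in> {1..k}" for i j
  proof -
    have "(\<Sum>j=1..k. (\<Sum>l\<in>UNIV. b i $ l * C l j) *s b j) = (\<Sum>l\<in>UNIV. b i $ l *s axis l 1)"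
      unfolding C by (simp add: vec_eq_iff sum_component sum_distrib_left sum_distrib_right mult_ac)
        (intro allI, rule sum.swap)
    also have "\<dots> = b i" by (rule basis_expansion)
    also have "\<dots> = (\<Sum>j=1..k. (if j = i then 1 else 0) *s b j)"
      using ij by (simp add: if_distrib[of "\<lambda>c. c *s _"] cong: if_cong)
    finally have "(\<Sum>l\<in>UNIV. b i $ l * C l j) = (if j = i then 1 else 0)"
      by (rule lattice_basis_unique[OF assms _ ij(2)])
    then show ?thesis by auto
  qed
  then show thesis by (rule that)
qed

lemma lattice_basis_prescribed_pairing:
  fixes b :: "nat \<Rightarrow> int^'n" and w :: "nat \<Rightarrow> int"
  assumes "lattice_basis b k UNIV"
  obtains y :: "int^'n" where "\<And>i. i \<in> {1..k} \<Longrightarrow> (\<Sum>l\<in>UNIV. b i $ l * y $ l) = w i"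
proof -
  obtain C where C: "\<And>i j. i \<in> {1..k} \<Longrightarrow> j \<in> {1..k} \<Longrightarrow>
      (\<Sum>l\<in>UNIV. b i $ l * C l j) = (if i = j then 1 else 0)"
    using lattice_basis_dual[OF assms] by blast
  let ?y = "\<chi> l. \<Sum>j=1..k. C l j * w j"
  have "(\<Sum>l\<in>UNIV. b i $ l * ?y $ l) = w i" if i: "i \<in> {1..k}" for i
  proof -
    have "(\<Sum>l\<in>UNIV. b i $ l * ?y $ l) = (\<Sum>j=1..k. (\<Sum>l\<in>UNIV. b i $ l * C l j) * w j)"
      by (simp add: sum_distrib_left sum_distrib_right mult_ac) (rule sum.swap)
    also have "\<dots> = (\<Sum>j=1..k. if i = j then w j else 0)"
    proof (rule sum.cong[OF refl])
      fix j assume "j \<in> {1..k}"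
      from C[OF i this] show "(\<Sum>l\<in>UNIV. b i $ l * C l j) * w j = (if i = j then w j else 0)"
        by simp
    qed
    also have "\<dots> = w i" using i by simp
    finally show ?thesis .
  qed
  then show thesis by (rule that)
qed

section \<open>An ample class\<close>

lemma convex_cone_hull_image:
  assumes "finite J" "x \<in> convex_cone hull (f ` J)"
  obtains c :: "'b \<Rightarrow> real" where "\<And>j. j \<in> J \<Longrightarrow> 0 \<le> c j" "x = (\<Sum>j\<in>J. c j *\<^sub>R f j)"
proof -
  let ?S = "{\<Sum>j\<in>J. c j *\<^sub>R f j | c. \<forall>j\<in>J. 0 \<le> c j}"
  have "convex_cone ?S"
    unfolding convex_cone_iff
  proof (intro conjI ballI allI impI)
    show "0 \<in> ?S" by (auto intro!: exI[of _ "\<lambda>_. 0"])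
  next
    fix x y assume "x \<in> ?S" "y \<in> ?S"
    then obtain c d where "x = (\<Sum>j\<in>J. c j *\<^sub>R f j)" "y = (\<Sum>j\<in>J. d j *\<^sub>R f j)"
        "\<forall>j\<in>J. 0 \<le> c j" "\<forall>j\<in>J. 0 \<le> d j" by auto
    then show "x + y \<in> ?S"
      by (auto intro!: exI[of _ "\<lambda>j. c j + d j"] simp: scaleR_add_left sum.distrib)
  next
    fix x and t :: real assume "x \<in> ?S" "0 \<le> t"
    then obtain c where "x = (\<Sum>j\<in>J. c j *\<^sub>R f j)" "\<forall>j\<in>J. 0 \<le> c j" by auto
    then show "t *\<^sub>R x \<in> ?S"
      using \<open>0 \<le> t\<close> by (auto intro!: exI[of _ "\<lambda>j. t * c j"] simp: scaleR_sum_right)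
  qed
  moreover have "f ` J \<subseteq> ?S"
  proof (rule image_subsetI)
    fix j assume "j \<in> J"
    then have "f j = (\<Sum>i\<in>J. (if i = j then 1 else 0) *\<^sub>R f i)"
      using assms(1) by (simp add: if_distrib[of "\<lambda>c. c *\<^sub>R _"] cong: if_cong)
    then show "f j \<in> ?S" by force
  qed
  ultimately have "convex_cone hull (f ` J) \<subseteq> ?S" by (rule hull_minimal[rotated])
  then show thesis using assms(2) that by auto
qed

lemma convex_cone_hull_sum:
  assumes "\<And>j. j \<in> I \<Longrightarrow> 0 \<le> c j \<and> f j \<in> S"
  shows "(\<Sum>j\<in>I. c j *\<^sub>R f j) \<in> convex_cone hull S"
  using assms
proof (induction I rule: infinite_finite_induct)
  case (insert i I)
  have "c i *\<^sub>R f i \<in> convex_cone hull S"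
    using insert.prems by (intro convex_cone_hull_mul hull_inc) auto
  then show ?case
    using insert by (auto intro: convex_cone_hull_add)
qed (simp_all add: convex_cone_hull_contains_0)

text \<open>A ray of the fan that lies in \<open>\<sigma>\<close> is a face of \<open>\<sigma>\<close>, hence extremal, hence spanned by one of the generators
  of \<open>\<sigma>\<close>. A primitive vector and a basis vector on the same ray coincide.\<close>

lemma ray_generator_in_basis:
  fixes v :: "int^'n"
  assumes fan: "fan \<Sigma>" and prim: "primitive_vec v"
    and ray: "ray v \<in> \<Sigma>" and \<sigma>: "\<sigma> \<in> \<Sigma>" and v: "real_vec v \<in> \<sigma>"
    and b: "lattice_basis b k (UNIV :: (int^'n) set)" and J: "J \<subseteq> {1..k}"
    and hull: "\<sigma> = convex_cone hull ((\<lambda>i. real_vec (b i)) ` J)"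
  shows "v \<in> b ` J"
proof -
  have finJ: "finite J" using J finite_subset by blast
  obtain c where c: "\<And>j. j \<in> J \<Longrightarrow> 0 \<le> c j" and vc: "real_vec v = (\<Sum>j\<in>J. c j *\<^sub>R real_vec (b j))"
    using convex_cone_hull_image[OF finJ] v hull by metis
  have "real_vec v \<noteq> 0"
    using prim by (auto simp: primitive_vec_def real_vec_def vec_eq_iff)
  then obtain j where j: "j \<in> J" "c j \<noteq> 0" 
    using vc by (metis (no_types, lifting) scaleR_zero_left sum.neutral)
  then have cj: "c j > 0" using c[of j] by simp
  \<comment> \<open>The summand of \<open>b j\<close> and the rest, doubled so that \<open>v\<close> is the midpoint of \<open>x\<close> and \<open>y\<close>.\<close>
  define x y where "x = (2 * c j) *\<^sub>R real_vec (b j)"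
    and "y = (\<Sum>i\<in>J - {j}. (2 * c i) *\<^sub>R real_vec (b i))"
  have x: "x \<in> \<sigma>" unfolding x_def hull using j cj
    by (intro convex_cone_hull_mul hull_inc) auto
  have y: "y \<in> \<sigma>" unfolding y_def hull using c
    by (intro convex_cone_hull_sum) auto
  have mid: "real_vec v = (1/2) *\<^sub>R x + (1/2) *\<^sub>R y"
    unfolding vc x_def y_def sum.remove[OF finJ j(1)] by (simp add: scaleR_sum_right)
  have v_ray: "real_vec v \<in> ray v"
    unfolding ray_def by (auto intro: exI[of _ 1])
  have face: "(ray v \<inter> \<sigma>) face_of \<sigma>"
    using fan ray \<sigma> unfolding fan_def by blast
  have "x \<in> ray v"
  proof (cases "x = y")
    case True
    then have "x = real_vec v" using mid by (simp flip: scaleR_add_left)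
    then show ?thesis using v_ray by simp
  next
    case False
    then have "real_vec v \<in> open_segment x y"
      using mid unfolding in_segment by (intro conjI exI[of _ "1/2"]) auto
    then show ?thesis
      using face_ofD[OF face _ x y] v_ray v by blast
  qed
  then obtain t where t: "t \<ge> 0" "x = t *\<^sub>R real_vec v" unfolding ray_def by auto
  define s where "s = t / (2 * c j)"
  have bs: "real_vec (b j) = s *\<^sub>R real_vec v"
  proof -
    have "real_vec (b j) = (1 / (2 * c j)) *\<^sub>R x" using cj by (simp add: x_def)
    then show ?thesis by (simp add: t s_def)
  qed
  \<comment> \<open>Pairing with \<open>z\<close> shows that \<open>1/s\<close> is the integer \<open>q\<close>.\<close>
  obtain z :: "int^'n" where z: "\<And>i. i \<in> {1..k} \<Longrightarrow> (\<Sum>l\<in>UNIV. b i $ l * z $ l) = 1"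
    using lattice_basis_prescribed_pairing[OF b, of "\<lambda>_. 1"] by blast
  define q where "q = (\<Sum>l\<in>UNIV. v $ l * z $ l)"
  have comp: "real_of_int (b j $ l) = s * real_of_int (v $ l)" for l
    using bs by (simp add: real_vec_def vec_eq_iff)
  have "1 = real_of_int (\<Sum>l\<in>UNIV. b j $ l * z $ l)" using z[of j] j(1) J by (simp add: subset_iff)
  also have "\<dots> = s * real_of_int q"
    by (simp add: comp q_def sum_distrib_left mult_ac)
  finally have sq: "s * real_of_int q = 1" by simp
  have "s \<ge> 0" using t cj by (simp add: s_def)
  have "v = q *s b j"
  proof (subst vec_eq_iff, intro allI)
    fix l
    have "real_of_int (q * b j $ l) = (s * real_of_int q) * real_of_int (v $ l)"
      by (simp add: comp)
    then show "v $ l = (q *s b j) $ l" using sq by (simp flip: of_int_mult)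
  qed
  then have "\<bar>q\<bar> = 1" using prim unfolding primitive_vec_def by blast
  then have "q = 1" using sq \<open>s \<ge> 0\<close> by (cases "q = - 1") auto
  then show ?thesis using \<open>v = q *s b j\<close> j by auto
qed

text \<open>Smoothness makes every class in \<open>Cl X\<close> trivial on the affine chart of \<open>\<sigma>\<close>: a divisor can be changed by the
  divisor of a character so that its coefficients on the rays of \<open>\<sigma>\<close> vanish. The generators of
  these rays are distinct members of a basis, so a character with given values on them exists.\<close>

lemma prescribed_values_on_cone:
  fixes phi :: "int^'n^'r::finite"
  assumes fan: "fan \<Sigma>" and smooth: "smooth_fan \<Sigma>" and rays: "primitive_ray_matrix \<Sigma> phi"
    and \<sigma>: "\<sigma> \<in> \<Sigma>"
  obtains y :: "int^'n" where "\<And>i. real_vec (row i phi) \<in> \<sigma> \<Longrightarrow> (phi *v y) $ i = u $ i"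
proof -
  obtain b J where b: "lattice_basis b CARD('n) (UNIV :: (int^'n) set)" "J \<subseteq> {1..CARD('n)}"
      "\<sigma> = convex_cone hull ((\<lambda>i. real_vec (b i)) ` J)"
    using smooth \<sigma> unfolding smooth_fan_def by blast
  have inj: "i = i'" if "row i phi = row i' phi" for i i'
    using rays that unfolding primitive_ray_matrix_def bij_betw_def inj_on_def by auto
  define w where "w j = u $ (THE i. row i phi = b j)" for j
  obtain y where y: "\<And>j. j \<in> {1..CARD('n)} \<Longrightarrow> (\<Sum>l\<in>UNIV. b j $ l * y $ l) = w j"
    using lattice_basis_prescribed_pairing[OF b(1)] by blast
  have "(phi *v y) $ i = u $ i" if i: "real_vec (row i phi) \<in> \<sigma>" for i
  proof -
    have "primitive_vec (row i phi)" "ray (row i phi) \<in> \<Sigma>"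
      using rays unfolding primitive_ray_matrix_def bij_betw_def by auto
    then obtain j where j: "j \<in> J" "row i phi = b j"
      using ray_generator_in_basis[OF fan _ _ \<sigma> i b] by auto
    have "(phi *v y) $ i = (\<Sum>l\<in>UNIV. row i phi $ l * y $ l)"
      by (simp add: matrix_vector_mult_def row_def)
    also have "\<dots> = w j" using y j b(2) by auto
    also have "\<dots> = u $ i"
      unfolding w_def using j inj by (metis (mono_tags, lifting) the_equality)
    finally show ?thesis .
  qed
  then show thesis by (rule that)
qed

text \<open>Every nonempty face has a vertex, and vertices of a lattice polytope are lattice points. This reduces
  questions about the cones of the fan to the normal cones of vertices, which have an integral support
  function.\<close>

lemma normal_cone_in_vertex_cone:
  assumes "finite G" and \<Sigma>: "\<Sigma> = {normal_cone P Q | Q. Q face_of P \<and> Q \<noteq> {}}"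
    and P: "P = convex hull (real_vec ` G)" and \<sigma>: "\<sigma> \<in> \<Sigma>"
  obtains x where "x \<in> G" "normal_cone P {real_vec x} \<in> \<Sigma>" "\<sigma> \<subseteq> normal_cone P {real_vec x}"
proof -
  obtain Q where Q: "Q face_of P" "Q \<noteq> {}" "\<sigma> = normal_cone P Q" using \<sigma> \<Sigma> by auto
  have "compact P" "convex P"
    using assms(1) by (auto simp: P intro: finite_imp_compact_convex_hull)
  then obtain z where z: "z extreme_point_of Q"
    using extreme_point_exists_convex[of Q] Q face_of_imp_compact face_of_imp_convex by metis
  then have "z extreme_point_of P" "z \<in> Q" using extreme_point_of_face[OF Q(1)] by auto
  moreover from this obtain x where x: "x \<in> G" "z = real_vec x"
    using extreme_point_of_convex_hull P by blast
  ultimately have "{real_vec x} face_of P" "real_vec x \<in> Q" by (auto simp: face_of_singleton)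
  then have "normal_cone P {real_vec x} \<in> \<Sigma>" "\<sigma> \<subseteq> normal_cone P {real_vec x}"
    unfolding \<Sigma> Q(3) by (blast, unfold normal_cone_def, blast)
  then show thesis using that x(1) by blast
qed

lemma real_vec_inner: "real_vec v \<bullet> real_vec x = real_of_int (\<Sum>l\<in>UNIV. v $ l * x $ l)"
  unfolding real_vec_def inner_vec_def by simp

lemma in_vertex_cone_iff:
  assumes "P = convex hull (real_vec ` G)"
  shows "real_vec v \<in> normal_cone P {real_vec x} \<longleftrightarrow>
    (\<forall>g\<in>G. (\<Sum>l\<in>UNIV. v $ l * x $ l) \<le> (\<Sum>l\<in>UNIV. v $ l * g $ l))"
proof -
  let ?H = "{y. real_vec v \<bullet> real_vec x \<le> real_vec v \<bullet> y}"
  have "real_vec v \<in> normal_cone P {real_vec x} \<longleftrightarrow> P \<subseteq> ?H"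
    by (auto simp: normal_cone_def)
  also have "\<dots> \<longleftrightarrow> real_vec ` G \<subseteq> ?H"
  proof
    assume "real_vec ` G \<subseteq> ?H"
    moreover have "convex ?H" by (rule convex_halfspace_ge)
    ultimately show "P \<subseteq> ?H" unfolding assms by (rule hull_minimal)
  next
    assume "P \<subseteq> ?H"
    with hull_subset[of "real_vec ` G" convex] show "real_vec ` G \<subseteq> ?H"
      unfolding assms by (rule order_trans)
  qed
  also have "\<dots> \<longleftrightarrow> (\<forall>g\<in>G. (\<Sum>l\<in>UNIV. v $ l * x $ l) \<le> (\<Sum>l\<in>UNIV. v $ l * g $ l))"
    unfolding image_subset_iff mem_Collect_eq real_vec_inner of_int_le_iff ..
  finally show ?thesis .
qed

lemma matrix_vector_mult_smult:
  fixes A :: "'a::comm_semiring_1^'m^'n"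
  shows "A *v (c *s x) = c *s (A *v x)"
  unfolding vec_eq_iff matrix_vector_mult_def vector_smult_component vec_lambda_beta sum_distrib_left
  by (intro allI sum.cong refl) (rule mult.left_commute)

text \<open>The class \<open>\<kappa>\<close> is that of the ample divisor \<open>h\<close> of the polytope. Over the chart of a vertex \<open>x\<close> it is
  represented by \<open>h + \<phi> x\<close>, whose coefficients vanish on the rays of the chart and are at least \<open>1\<close> on the
  other rays, so a large multiple absorbs a representative of \<open>e\<close> that vanishes on the rays of the chart.\<close>

lemma nef_degrees_absorbing:
  fixes phi :: "int^'n^'r::finite" and beta :: "int^'r^'d::finite"
  assumes fan: "fan \<Sigma>" and smooth: "smooth_fan \<Sigma>" and proj: "projective_fan \<Sigma>"
    and rays: "primitive_ray_matrix \<Sigma> phi" and exact: "short_exact phi beta"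
  obtains \<kappa> where "\<And>e. \<forall>\<^sub>F M in sequentially. int M *s \<kappa> + e \<in> nef_degrees \<Sigma> phi beta"
proof -
  obtain G P where G: "finite G" and P: "P = convex hull (real_vec ` G)"
    and dim: "aff_dim P = int CARD('n)" and \<Sigma>: "\<Sigma> = {normal_cone P Q | Q. Q face_of P \<and> Q \<noteq> {}}"
    using proj unfolding projective_fan_def by blast
  have "G \<noteq> {}" using dim P by auto
  define h :: "int^'r" where "h = (\<chi> i. - Min ((\<lambda>g. (phi *v g) $ i) ` G))"
  have phi_comp: "(phi *v x) $ i = (\<Sum>l\<in>UNIV. row i phi $ l * x $ l)" for x i
    by (simp add: matrix_vector_mult_def row_def)
  have zero: "beta *v (phi *v x) = 0" for x
    using exact unfolding short_exact_def by blast
  have "\<forall>\<^sub>F M in sequentially. int M *s (beta *v h) + e \<in> nef_degrees \<Sigma> phi beta" for e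
  proof -
    obtain u where u: "e = beta *v u" using exact unfolding short_exact_def by (meson surjD)
    have "\<forall>\<^sub>F M in sequentially. \<forall>\<sigma>\<in>\<Sigma>. \<exists>c. (\<forall>i. ray (row i phi) \<subseteq> \<sigma> \<longrightarrow> c i = 0) \<and>
        int M *s (beta *v h) + e = (\<Sum>i\<in>UNIV. int (c i) *s column i beta)"
    proof (rule eventually_ball_finite)
      show "finite \<Sigma>" using fan by (simp add: fan_def)
      show "\<forall>\<sigma>\<in>\<Sigma>. \<forall>\<^sub>F M in sequentially. \<exists>c. (\<forall>i. ray (row i phi) \<subseteq> \<sigma> \<longrightarrow> c i = 0) \<and>
        int M *s (beta *v h) + e = (\<Sum>i\<in>UNIV. int (c i) *s column i beta)"
      proof
        fix \<sigma> assume "\<sigma> \<in> \<Sigma>"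
        then obtain x where x: "x \<in> G" and vert: "normal_cone P {real_vec x} \<in> \<Sigma>"
          and sub: "\<sigma> \<subseteq> normal_cone P {real_vec x}"
          using normal_cone_in_vertex_cone[OF G \<Sigma> P] by blast
        let ?\<tau> = "normal_cone P {real_vec x}"
        obtain y where y: "\<And>i. real_vec (row i phi) \<in> ?\<tau> \<Longrightarrow> (phi *v y) $ i = u $ i"
          using prescribed_values_on_cone[OF fan smooth rays vert] by blast
        define c where "c = h + phi *v x"
        define \<epsilon> where "\<epsilon> = u - phi *v y"
        have c_zero: "c $ i = 0" if "real_vec (row i phi) \<in> ?\<tau>" for i
        proof -
          have "Min ((\<lambda>g. (phi *v g) $ i) ` G) = (phi *v x) $ i"
            using that G x by (intro Min_eqI) (auto simp: in_vertex_cone_iff[OF P] phi_comp)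
          then show ?thesis by (simp add: c_def h_def)
        qed
        have c_pos: "c $ i \<ge> 1" if out: "real_vec (row i phi) \<notin> ?\<tau>" for i
        proof -
          obtain g where g: "g \<in> G" "(phi *v g) $ i < (phi *v x) $ i"
            using out by (auto simp: in_vertex_cone_iff[OF P] phi_comp not_le)
          then have "Min ((\<lambda>g. (phi *v g) $ i) ` G) < (phi *v x) $ i"
            using G by (intro le_less_trans[OF Min_le]) auto
          then show ?thesis by (simp add: c_def h_def)
        qed
        let ?N = "nat (\<Sum>i\<in>UNIV. \<bar>\<epsilon> $ i\<bar>)"
        show "\<forall>\<^sub>F M in sequentially. \<exists>c. (\<forall>i. ray (row i phi) \<subseteq> \<sigma> \<longrightarrow> c i = 0) \<and>
          int M *s (beta *v h) + e = (\<Sum>i\<in>UNIV. int (c i) *s column i beta)"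
          unfolding eventually_sequentially
        proof (intro exI[of _ ?N] allI impI)
          fix M assume M: "?N \<le> M"
          define w where "w = int M *s c + \<epsilon>"
          have w_ge: "w $ i \<ge> 0" for i
          proof (cases "real_vec (row i phi) \<in> ?\<tau>")
            case True
            then show ?thesis using y c_zero by (simp add: w_def \<epsilon>_def)
          next
            case False
            have "\<bar>\<epsilon> $ i\<bar> \<le> (\<Sum>i\<in>UNIV. \<bar>\<epsilon> $ i\<bar>)" by (rule member_le_sum) auto
            then have "- (\<epsilon> $ i) \<le> int M" using M by linarith
            also have "\<dots> \<le> int M * c $ i" using c_pos[OF False] by (simp add: mult_le_cancel_left1)
            finally show ?thesis by (simp add: w_def)
          qed
          have w_zero: "w $ i = 0" if "ray (row i phi) \<subseteq> \<sigma>" for i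
          proof -
            have "real_vec (row i phi) \<in> ray (row i phi)"
              unfolding ray_def by (auto intro: exI[of _ 1])
            then have "real_vec (row i phi) \<in> ?\<tau>" using that sub by blast
            then show ?thesis using y c_zero by (simp add: w_def \<epsilon>_def)
          qed
          have "int M *s (beta *v h) + e = beta *v w"
            by (simp add: w_def c_def \<epsilon>_def u zero matrix_vector_right_distrib
                matrix_vector_mult_diff_distrib matrix_vector_mult_smult)
          also have "\<dots> = (\<Sum>i\<in>UNIV. int (nat (w $ i)) *s column i beta)"
            using w_ge by (simp add: matrix_mult_sum)
          finally show "\<exists>c. (\<forall>i. ray (row i phi) \<subseteq> \<sigma> \<longrightarrow> c i = 0) \<and>
              int M *s (beta *v h) + e = (\<Sum>i\<in>UNIV. int (c i) *s column i beta)"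
            using w_zero by (intro exI[of _ "\<lambda>i. nat (w $ i)"]) auto
        qed
      qed
    qed
    then show ?thesis
      by (rule eventually_mono) (force simp: nef_degrees_def)
  qed
  then show thesis by (rule that)
qed

section \<open>The Hilbert polynomial\<close>

lemma eval_const_poly [simp]: "eval_poly (const_poly c) a = c"
  by (simp add: eval_poly_def const_poly_def)

lemma nef_degree_effective:
  assumes "fan \<Sigma>" "\<kappa> \<in> nef_degrees \<Sigma> phi beta"
  obtains c :: "'r::finite \<Rightarrow> nat" where "\<kappa> = beta *v (\<chi> i. int (c i))"
proof -
  obtain \<sigma> where "\<sigma> \<in> \<Sigma>" using assms(1) unfolding fan_def by blast
  then obtain c :: "'r \<Rightarrow> nat" where "\<kappa> = (\<Sum>i\<in>UNIV. int (c i) *s column i beta)"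
    using assms(2) unfolding nef_degrees_def by blast
  then have "\<kappa> = beta *v (\<chi> i. int (c i))" by (simp add: matrix_mult_sum)
  then show thesis by (rule that)
qed

lemma finite_int_box: "finite {z :: int^'i::finite. \<forall>j. 0 \<le> z $ j \<and> z $ j \<le> D}"
proof (rule finite_subset)
  show "{z :: int^'i. \<forall>j. 0 \<le> z $ j \<and> z $ j \<le> D} \<subseteq> vec_lambda ` (\<Pi>\<^sub>E j\<in>UNIV. {0..D})"
  proof
    fix z :: "int^'i" assume "z \<in> {z. \<forall>j. 0 \<le> z $ j \<and> z $ j \<le> D}"
    then have "vec_nth z \<in> (\<Pi>\<^sub>E j\<in>UNIV. {0..D})" by auto
    then have "vec_lambda (vec_nth z) \<in> vec_lambda ` (\<Pi>\<^sub>E j\<in>UNIV. {0..D})" by (rule imageI)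
    then show "z \<in> vec_lambda ` (\<Pi>\<^sub>E j\<in>UNIV. {0..D})" by simp
  qed
  show "finite (vec_lambda ` (\<Pi>\<^sub>E j\<in>(UNIV :: 'i set). {0..D}))"
    by (intro finite_imageI finite_PiE) auto
qed

text \<open>The translate \<open>a\<close> is the class of a vector with all entries equal to \<open>N\<close>. Adding it to a nonnegative
  representative of a nef degree makes all entries large enough to count the cosets.\<close>

lemma lattice_ideal_hilbert_function:
  fixes m :: "nat \<Rightarrow> int^'r::finite" and beta :: "int^'r^'d::finite"
  assumes fan: "fan \<Sigma>"
    and m: "lattice_basis m k {x. beta *v x = 0}"
    and L: "lattice_basis (\<lambda>i. int (d i) *s m i) k L" and sub: "L \<subseteq> {x. beta *v x = 0}"
    and pos: "\<And>i. i \<in> {1..k} \<Longrightarrow> 0 < d i"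
  obtains a where
    "\<And>\<kappa>. \<kappa> \<in> nef_degrees \<Sigma> phi beta \<Longrightarrow>
      \<exists>B. quotient_basis beta (lattice_ideal L :: ('r, 'k::field) mpoly set) (a + \<kappa>) B"
    "\<And>\<kappa>. \<kappa> \<in> nef_degrees \<Sigma> phi beta \<Longrightarrow>
      hilbert_function beta (lattice_ideal L :: ('r, 'k::field) mpoly set) (a + \<kappa>) = (\<Prod>i=1..k. d i)"
proof -
  interpret exponent_lattice L by (rule exponent_lattice_if_basis[OF L])
  define N where "N = (\<Sum>j\<in>UNIV. \<Sum>i=1..k. int (d i) * \<bar>m i $ j\<bar>)"
  have N: "(\<Sum>i=1..k. int (d i) * \<bar>m i $ j\<bar>) \<le> N" for j
    unfolding N_def by (rule member_le_sum) (auto intro: sum_nonneg)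
  have N0: "0 \<le> N" unfolding N_def by (intro sum_nonneg) auto
  define a where "a = beta *v (\<chi> j. N)"
  have *: "finite (rep ` fibre beta (a + \<kappa>)) \<and> card (rep ` fibre beta (a + \<kappa>)) = (\<Prod>i=1..k. d i)"
    if \<kappa>: "\<kappa> \<in> nef_degrees \<Sigma> phi beta" for \<kappa>
  proof -
    obtain c :: "'r \<Rightarrow> nat" where c: "\<kappa> = beta *v (\<chi> i. int (c i))"
      using nef_degree_effective[OF fan \<kappa>] by blast
    define u :: "nat^'r" where "u = (\<chi> j. nat N + c j)"
    have "int_exponent u = (\<chi> j. N) + (\<chi> i. int (c i))"
      using N0 by (simp add: u_def int_exponent_def vec_eq_iff)
    then have "beta *v int_exponent u = a + \<kappa>"
      by (simp add: a_def c matrix_vector_right_distrib)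
    moreover have "(\<Sum>i=1..k. int (d i) * \<bar>m i $ j\<bar>) \<le> int (u $ j)" for j
      using N[of j] N0 by (simp add: u_def)
    ultimately show ?thesis using card_cosets_in_fibre[OF m L pos] by blast
  qed
  show thesis
  proof (rule that[of a])
    fix \<kappa> assume "\<kappa> \<in> nef_degrees \<Sigma> phi beta"
    note fin = conjunct1[OF *[OF this]] and card = conjunct2[OF *[OF this]]
    show "\<exists>B. quotient_basis beta (lattice_ideal L :: ('r, 'k) mpoly set) (a + \<kappa>) B"
      by (rule exI, rule quotient_basis_monomials[OF fin sub])
    show "hilbert_function beta (lattice_ideal L :: ('r, 'k) mpoly set) (a + \<kappa>) = (\<Prod>i=1..k. d i)"
      unfolding card[symmetric] by (rule hilbert_function_lattice_ideal[OF fin sub])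
  qed
qed

text \<open>For uniqueness, a polynomial that is a Hilbert polynomial on the translate by \<open>a'\<close> agrees with the constant
  on the part of this translate that lies in the translate by \<open>a\<close>, and this part contains a box that is larger
  than all the exponents.\<close>

lemma hilbert_polynomial_lattice_ideal:
  fixes phi :: "int^'n^'r::finite" and beta :: "int^'r^'d::finite" and p :: "('d, rat) mpoly"
  assumes fan: "fan \<Sigma>" and smooth: "smooth_fan \<Sigma>" and proj: "projective_fan \<Sigma>"
    and rays: "primitive_ray_matrix \<Sigma> phi" and exact: "short_exact phi beta"
    and m: "lattice_basis m k {x. beta *v x = 0}"
    and L: "lattice_basis (\<lambda>i. int (d i) *s m i) k L" and sub: "L \<subseteq> {x. beta *v x = 0}"
    and pos: "\<And>i. i \<in> {1..k} \<Longrightarrow> 0 < d i"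
  shows "is_hilbert_polynomial \<Sigma> phi beta (lattice_ideal L :: ('r, 'k::field) mpoly set) p
    \<longleftrightarrow> p = const_poly (of_nat (\<Prod>i=1..k. d i))" (is "?hp p \<longleftrightarrow> p = ?c")
proof -
  let ?K = "nef_degrees \<Sigma> phi beta"
  let ?h = "hilbert_function beta (lattice_ideal L :: ('r, 'k) mpoly set)"
  obtain a where a: "\<And>\<kappa>. \<kappa> \<in> ?K \<Longrightarrow>
        \<exists>B. quotient_basis beta (lattice_ideal L :: ('r, 'k) mpoly set) (a + \<kappa>) B"
      "\<And>\<kappa>. \<kappa> \<in> ?K \<Longrightarrow> ?h (a + \<kappa>) = (\<Prod>i=1..k. d i)"
    using lattice_ideal_hilbert_function[OF fan m L sub pos, where 'k='k] by blast
  have hp_c: "?hp ?c"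
    unfolding is_hilbert_polynomial_def by (rule exI[of _ a]) (use a in auto)
  have "p = ?c" if p: "?hp p"
  proof -
    obtain a' where a': "\<And>\<kappa>. \<kappa> \<in> ?K \<Longrightarrow> eval_poly p (a' + \<kappa>) = of_nat (?h (a' + \<kappa>))"
      using p unfolding is_hilbert_polynomial_def by blast
    obtain \<kappa> where \<kappa>: "\<And>e. \<forall>\<^sub>F M in sequentially. int M *s \<kappa> + e \<in> ?K"
      using nef_degrees_absorbing[OF fan smooth proj rays exact] by blast
    let ?E = "Poly_Mapping.keys p \<union> Poly_Mapping.keys ?c"
    define D where "D = (\<Sum>e\<in>?E. \<Sum>j\<in>UNIV. e $ j)"
    have D: "e $ j \<le> D" if "e \<in> ?E" for e j
    proof -
      have "e $ j \<le> (\<Sum>j\<in>UNIV. e $ j)" by (rule member_le_sum) auto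
      also have "\<dots> \<le> D" unfolding D_def by (rule member_le_sum) (use that in auto)
      finally show ?thesis .
    qed
    let ?box = "{z :: int^'d. \<forall>j. 0 \<le> z $ j \<and> z $ j \<le> int D}"
    have "\<forall>\<^sub>F M in sequentially. \<forall>z\<in>?box. int M *s \<kappa> + z \<in> ?K \<and> int M *s \<kappa> + (z + a' - a) \<in> ?K"
      by (intro eventually_ball_finite finite_int_box ballI eventually_conj \<kappa>)
    then obtain M where M: "\<And>z. z \<in> ?box \<Longrightarrow> int M *s \<kappa> + z \<in> ?K"
        "\<And>z. z \<in> ?box \<Longrightarrow> int M *s \<kappa> + (z + a' - a) \<in> ?K"
      using eventually_happens'[OF sequentially_bot] by (metis (no_types, lifting))
    show "p = ?c"
    proof (rule eval_poly_determined_by_box[OF D])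
      fix z :: "int^'d" assume "\<And>j. 0 \<le> z $ j \<and> z $ j \<le> int D"
      then have z: "z \<in> ?box" by simp
      have shift: "a' + (int M *s \<kappa> + z) = a + (int M *s \<kappa> + (z + a' - a))"
        by (simp add: algebra_simps)
      have "eval_poly p (a' + int M *s \<kappa> + z) = of_nat (?h (a' + (int M *s \<kappa> + z)))"
        using a'[OF M(1)[OF z]] by (simp only: add.assoc)
      also have "\<dots> = of_nat (\<Prod>i=1..k. d i)"
        unfolding shift using a(2)[OF M(2)[OF z]] by simp
      finally show "eval_poly p (a' + int M *s \<kappa> + z) = eval_poly ?c (a' + int M *s \<kappa> + z)"
        by simp
    qed
  qed
  then show ?thesis using hp_c by blast
qed

section \<open>Volume of a parallelepiped\<close>

text \<open>The change of variables formula for linear maps is stated for coordinates indexed by a well-ordered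
  type. This copy of a finite type carries the well-order of an enumeration.\<close>

typedef 'a ranked = "UNIV :: 'a set" morphisms label ranked ..

instance ranked :: (finite) finite
proof
  have "(UNIV :: 'a ranked set) = range ranked"
    by (metis label_inverse surj_def)
  then show "finite (UNIV :: 'a ranked set)" by (metis finite finite_imageI)
qed

instantiation ranked :: (finite) wellorder
begin

definition less_eq_ranked :: "'a ranked \<Rightarrow> 'a ranked \<Rightarrow> bool" where
  "x \<le> y \<longleftrightarrow> to_nat (label x) \<le> to_nat (label y)"

definition less_ranked :: "'a ranked \<Rightarrow> 'a ranked \<Rightarrow> bool" where
  "x < y \<longleftrightarrow> to_nat (label x) < to_nat (label y)"

instance
proof
  fix x y z :: "'a ranked"
  show "x < y \<longleftrightarrow> x \<le> y \<and> \<not> y \<le> x" "x \<le> x" "x \<le> y \<or> y \<le> x"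
    by (auto simp: less_eq_ranked_def less_ranked_def)
  show "x \<le> y \<Longrightarrow> y \<le> z \<Longrightarrow> x \<le> z"
    by (simp add: less_eq_ranked_def)
  show "x \<le> y \<Longrightarrow> y \<le> x \<Longrightarrow> x = y"
    by (simp add: less_eq_ranked_def label_inject)
next
  fix P :: "'a ranked \<Rightarrow> bool" and a
  assume *: "\<And>x. (\<And>y. y < x \<Longrightarrow> P y) \<Longrightarrow> P x"
  show "P a"
    by (induction a rule: measure_induct_rule[of "\<lambda>x. to_nat (label x)"])
      (rule *, simp add: less_ranked_def)
qed

end

lemma bij_label: "bij (label :: 'a ranked \<Rightarrow> 'a)"
  by (metis bij_betw_byWitness bijI' label_inject label_inverse ranked_inverse UNIV_I)

lemma prod_label: "(\<Prod>i\<in>UNIV. f (label i)) = prod f UNIV"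
  using prod.reindex_bij_betw[OF bij_label] .

definition relabel :: "real^'n \<Rightarrow> real^'n ranked" where
  "relabel x = (\<chi> i. x $ label i)"

definition unlabel :: "real^'n ranked \<Rightarrow> real^'n" where
  "unlabel y = (\<chi> k. y $ ranked k)"

lemma unlabel_relabel [simp]: "unlabel (relabel x) = x"
  by (simp add: relabel_def unlabel_def ranked_inverse)

lemma relabel_unlabel [simp]: "relabel (unlabel y) = y"
  by (simp add: relabel_def unlabel_def label_inverse)

lemma measurable_unlabel:
  "unlabel \<in> borel_measurable (borel :: (real^'n::finite ranked) measure)"
proof -
  have "linear unlabel" by (auto intro!: linearI simp: unlabel_def vec_eq_iff)
  then show ?thesis
    by (intro borel_measurable_continuous_onI linear_continuous_on)
      (simp add: linear_conv_bounded_linear)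
qed

lemma prod_Basis_cart: "(\<Prod>b\<in>Basis. x \<bullet> b) = (\<Prod>i\<in>UNIV. (x :: real^'n) $ i)"
  by (simp add: Basis_vec_def cart_eq_inner_axis axis_eq_axis prod.UNION_disjoint)

text \<open>Renaming the coordinates maps boxes to boxes with the same side lengths, and these values determine
  Lebesgue measure.\<close>

lemma distr_unlabel_lborel: "distr lborel borel unlabel = (lborel :: (real^'n::finite) measure)"
proof (rule lborel_eqI[symmetric])
  fix l u :: "real^'n" assume "\<And>b. b \<in> Basis \<Longrightarrow> l \<bullet> b \<le> u \<bullet> b"
  then have le: "l $ i \<le> u $ i" for i by (simp add: cart_eq_inner_axis)
  have "unlabel -` box l u = box (relabel l) (relabel u)"
    by (auto simp: mem_box_cart unlabel_def relabel_def)
      (metis label_inverse, metis label_inverse, metis UNIV_I ranked_inverse, metis UNIV_I ranked_inverse)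
  then have "emeasure (distr lborel borel unlabel) (box l u) = emeasure lborel (box (relabel l) (relabel u))"
    by (simp add: emeasure_distr measurable_unlabel)
  also have "\<dots> = (\<Prod>b\<in>Basis. (relabel u - relabel l) \<bullet> b)"
    by (rule emeasure_lborel_box) (auto simp: Basis_vec_def inner_axis relabel_def le)
  also have "\<dots> = (\<Prod>b\<in>Basis. (u - l) \<bullet> b)"
    unfolding prod_Basis_cart using prod_label[of "\<lambda>k. u $ k - l $ k"] by (simp add: relabel_def)
  finally show "emeasure (distr lborel borel unlabel) (box l u) = (\<Prod>b\<in>Basis. (u - l) \<bullet> b)" .
qed simp

lemma measure_relabel_image:
  assumes "S \<in> sets borel"
  shows "measure lborel (relabel ` S) = measure lborel (S :: (real^'n::finite) set)"
proof -
  have "y \<in> relabel ` S" if "unlabel y \<in> S" for y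
    using imageI[OF that, of relabel] by simp
  then have "unlabel -` S = relabel ` S" by auto
  then show ?thesis
    using assms by (subst (2) distr_unlabel_lborel[symmetric])
      (simp add: measure_distr measurable_unlabel)
qed

lemma measure_parallelepiped:
  fixes w :: "'n::finite \<Rightarrow> real^'n"
  shows "measure lebesgue ((\<lambda>t. \<Sum>k\<in>UNIV. t $ k *\<^sub>R w k) ` cbox (0 :: real^'n) 1)
    = \<bar>det (\<chi> k i. w (label k) $ label i)\<bar>" (is "measure lebesgue (?f ` _) = \<bar>det ?A\<bar>")
proof -
  define g :: "real^'n ranked \<Rightarrow> real^'n ranked" where "g = (\<lambda>t. transpose ?A *v t)"
  have cont: "continuous_on S ?f" for S
    by (intro continuous_intros)
  have comp: "compact (?f ` cbox 0 1)"
    by (intro compact_continuous_image cont compact_cbox)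
  have img: "relabel ` ?f ` cbox 0 1 = g ` cbox 0 1"
  proof -
    have "relabel (?f t) = g (relabel t)" for t
    proof -
      have "(\<Sum>k\<in>UNIV. t $ k * w k $ label i) = (\<Sum>k\<in>UNIV. w (label k) $ label i * t $ label k)" for i
        using sum.reindex_bij_betw[OF bij_label, of "\<lambda>k. t $ k * w k $ label i"]
        by (simp add: mult.commute)
      then show ?thesis
        by (simp add: relabel_def g_def vec_eq_iff matrix_vector_mult_def transpose_def sum_component)
    qed
    moreover have "relabel ` cbox (0 :: real^'n) 1 = cbox 0 1"
    proof (intro subset_antisym subsetI)
      fix y :: "real^'n ranked" assume "y \<in> cbox 0 1"
      then have "unlabel y \<in> cbox 0 1" by (simp add: mem_box_cart unlabel_def)
      then have "relabel (unlabel y) \<in> relabel ` cbox 0 1" by (rule imageI)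
      then show "y \<in> relabel ` cbox 0 1" by simp
    qed (auto simp: mem_box_cart relabel_def)
    ultimately show ?thesis by (metis (no_types, lifting) image_cong image_image)
  qed
  have "measure lebesgue (?f ` cbox 0 1) = measure lborel (?f ` cbox 0 1)"
    using comp by (simp add: measure_completion borel_compact)
  also have "\<dots> = measure lborel (g ` cbox 0 1)"
    unfolding img[symmetric] by (rule measure_relabel_image[symmetric]) (rule borel_compact[OF comp])
  also have "\<dots> = measure lebesgue (g ` cbox 0 1)"
  proof -
    have "compact (g ` cbox 0 1)"
      unfolding g_def by (intro compact_continuous_image compact_cbox matrix_vector_mult_linear_continuous_on)
    then show ?thesis by (simp add: measure_completion borel_compact)
  qed
  also have "\<dots> = \<bar>det (matrix g)\<bar> * measure lebesgue (cbox (0 :: real^'n ranked) 1)"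
    by (rule measure_linear_image) (simp_all only: g_def matrix_vector_mul_linear lmeasurable_cbox)
  also have "matrix g = transpose ?A" unfolding g_def by (rule matrix_of_matrix_vector_mul)
  also have "measure lebesgue (cbox (0 :: real^'n ranked) 1) = 1"
    by (simp add: measure_completion content_cbox_if_cart interval_eq_empty_cart not_less)
  finally show ?thesis by (simp add: det_transpose)
qed

section \<open>Sums of segments\<close>

definition set_sum :: "('k \<Rightarrow> (real^'n) set) \<Rightarrow> 'k set \<Rightarrow> (real^'n) set" where
  "set_sum S J = {\<Sum>k\<in>J. x k | x. \<forall>k\<in>J. x k \<in> S k}"

lemma set_sum_empty [simp]: "set_sum S {} = {0}"
  by (simp add: set_sum_def)

lemma set_sum_insert:
  assumes "finite J" "k \<notin> J"
  shows "set_sum S (insert k J) = minkowski_comb 1 (S k) 1 (set_sum S J)"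
proof (intro subset_antisym subsetI)
  fix y assume "y \<in> set_sum S (insert k J)"
  then obtain x where x: "\<forall>i\<in>insert k J. x i \<in> S i" "y = (\<Sum>i\<in>insert k J. x i)"
    unfolding set_sum_def by auto
  then show "y \<in> minkowski_comb 1 (S k) 1 (set_sum S J)"
    unfolding minkowski_comb_def set_sum_def using assms by auto
next
  fix y assume "y \<in> minkowski_comb 1 (S k) 1 (set_sum S J)"
  then obtain z x where zx: "z \<in> S k" "\<forall>i\<in>J. x i \<in> S i" "y = z + (\<Sum>i\<in>J. x i)"
    unfolding minkowski_comb_def set_sum_def by auto
  have "(\<Sum>i\<in>J. (x(k := z)) i) = (\<Sum>i\<in>J. x i)"
    using assms by (intro sum.cong) auto
  then have "y = (\<Sum>i\<in>insert k J. (x(k := z)) i)" using zx assms by simp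
  moreover have "\<forall>i\<in>insert k J. (x(k := z)) i \<in> S i" using zx assms by auto
  ultimately show "y \<in> set_sum S (insert k J)" unfolding set_sum_def by blast
qed

text \<open>A sum of segments is a translate of a linear image of the unit cube. The vectors outside \<open>J\<close> are
  replaced by \<open>0\<close> in order that the cube has the same dimension for every \<open>J\<close>.\<close>

lemma set_sum_segments:
  fixes a w :: "'n::finite \<Rightarrow> real^'n"
  assumes S: "\<And>k. S k = closed_segment (a k) (a k + w k)"
  shows "set_sum S J = (+) (\<Sum>k\<in>J. a k) `
    ((\<lambda>t. \<Sum>k\<in>UNIV. t $ k *\<^sub>R (if k \<in> J then w k else 0)) ` cbox (0 :: real^'n) 1)" (is "_ = _ ` ?f ` _")
proof -
  have sum_J: "(\<Sum>k\<in>UNIV. t $ k *\<^sub>R (if k \<in> J then w k else 0)) = (\<Sum>k\<in>J. t $ k *\<^sub>R w k)" for t :: "real^'n"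
    by (intro sum.mono_neutral_cong_right) auto
  have "y \<in> (+) (\<Sum>k\<in>J. a k) ` ?f ` cbox 0 1" if y: "y \<in> set_sum S J" for y
  proof -
    from y obtain x where x: "\<forall>k\<in>J. x k \<in> S k" "y = (\<Sum>k\<in>J. x k)" unfolding set_sum_def by blast
    have "\<exists>t. 0 \<le> t \<and> t \<le> 1 \<and> x k = a k + t *\<^sub>R w k" if "k \<in> J" for k
    proof -
      have "x k \<in> closed_segment (a k) (a k + w k)" using x(1) that by (simp flip: S)
      then obtain t where "0 \<le> t" "t \<le> 1" "x k = (1 - t) *\<^sub>R a k + t *\<^sub>R (a k + w k)"
        by (auto simp: in_segment)
      then show ?thesis by (intro exI[of _ t]) (simp add: algebra_simps)
    qed
    then obtain t where t: "\<And>k. k \<in> J \<Longrightarrow> 0 \<le> t k \<and> t k \<le> 1 \<and> x k = a k + t k *\<^sub>R w k" by metis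
    define s :: "real^'n" where "s = (\<chi> k. if k \<in> J then t k else 0)"
    have "s \<in> cbox 0 1" using t by (simp add: s_def mem_box_cart)
    moreover have "y = (\<Sum>k\<in>J. a k) + ?f s"
      unfolding sum_J x(2) sum.distrib[symmetric] by (rule sum.cong) (simp_all add: t s_def)
    ultimately show ?thesis by (intro image_eqI[OF _ imageI])
  qed
  moreover have "(\<Sum>k\<in>J. a k) + ?f s \<in> set_sum S J" if s: "s \<in> cbox 0 1" for s :: "real^'n"
  proof -
    have "(\<Sum>k\<in>J. a k) + ?f s = (\<Sum>k\<in>J. a k + s $ k *\<^sub>R w k)" unfolding sum_J sum.distrib ..
    moreover have "a k + s $ k *\<^sub>R w k \<in> S k" for k
    proof -
      have "0 \<le> s $ k" "s $ k \<le> 1" using s by (auto simp: mem_box_cart)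
      then show ?thesis
        unfolding S in_segment by (intro conjI exI[of _ "s $ k"]) (simp_all add: algebra_simps)
    qed
    ultimately show ?thesis unfolding set_sum_def by auto
  qed
  ultimately show ?thesis by (intro subset_antisym subsetI) auto
qed

lemma nonempty_polytope_set_sum_segments:
  fixes a w :: "'n::finite \<Rightarrow> real^'n"
  assumes S: "\<And>k. S k = closed_segment (a k) (a k + w k)"
  shows "nonempty_polytope (set_sum S J)"
proof -
  have "linear (\<lambda>t :: real^'n. \<Sum>k\<in>UNIV. t $ k *\<^sub>R (if k \<in> J then w k else 0))"
    by (auto intro!: linearI simp: scaleR_add_left sum.distrib scaleR_sum_right)
  moreover have "cbox (0 :: real^'n) 1 \<noteq> {}"
    by (simp add: interval_eq_empty_cart not_less)
  ultimately show ?thesis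
    unfolding nonempty_polytope_def set_sum_segments[OF S] polytope_translation_eq
    by (auto intro!: polytope_linear_image polytope_interval)
qed

text \<open>If a direction is left out, the determinant has a zero row.\<close>

lemma measure_set_sum_segments:
  fixes a w :: "'n::finite \<Rightarrow> real^'n"
  assumes S: "\<And>k. S k = closed_segment (a k) (a k + w k)"
  shows "measure lebesgue (set_sum S J) =
    (if J = UNIV then \<bar>det (\<chi> k i. w (label k) $ label i)\<bar> else 0)"
proof (cases "J = UNIV")
  case True
  then show ?thesis
    unfolding set_sum_segments[OF S] measure_translation measure_parallelepiped by simp
next
  case False
  then obtain l where "l \<notin> J" by blast
  then have "row (ranked l) (\<chi> k i. (if label k \<in> J then w (label k) else 0) $ label i) = 0"
    by (simp add: row_def vec_eq_iff ranked_inverse)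
  then show ?thesis
    unfolding set_sum_segments[OF S] measure_translation measure_parallelepiped
    using False by (simp add: det_zero_row)
qed

section \<open>Mixed volumes of segments\<close>

lemma mixed_volume_slot_linear:
  fixes g :: "nat \<Rightarrow> (real^'n::finite) set"
  assumes V: "is_mixed_volume V" and g: "\<And>j. nonempty_polytope (g j)" and i: "i < CARD('n)"
    and PQ: "nonempty_polytope P" "nonempty_polytope Q" and st: "0 \<le> s" "0 \<le> t"
  shows "V (map (g(i := minkowski_comb s P t Q)) [0..<CARD('n)]) =
    s * V (map (g(i := P)) [0..<CARD('n)]) + t * V (map (g(i := Q)) [0..<CARD('n)])"
proof -
  have upd: "map (g(i := X)) [0..<CARD('n)] = (map g [0..<CARD('n)])[i := X]" for X
    by (rule nth_equalityI) (auto simp: nth_list_update)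
  have "list_all nonempty_polytope (map g [0..<CARD('n)])"
    using g by (simp add: list_all_iff)
  then show ?thesis
    using V i PQ st unfolding is_mixed_volume_def upd by simp
qed

text \<open>Homogeneity with both coefficients equal to \<open>0\<close> gives the value \<open>0\<close> on the one-point set \<open>{0}\<close>, which
  is the empty sum.\<close>

lemma mixed_volume_slot_sum:
  fixes g :: "nat \<Rightarrow> (real^'n::finite) set"
  assumes V: "is_mixed_volume V" and g: "\<And>j. nonempty_polytope (g j)" and i: "i < CARD('n)"
    and S: "\<And>k. nonempty_polytope (S k)" and sums: "\<And>J. nonempty_polytope (set_sum S J)"
    and J: "finite J"
  shows "V (map (g(i := set_sum S J)) [0..<CARD('n)]) = (\<Sum>k\<in>J. V (map (g(i := S k)) [0..<CARD('n)]))"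
  using J
proof (induction J rule: finite_induct)
  case empty
  have "minkowski_comb 0 (g i) 0 (g i) = {0}"
    using g[of i] by (auto simp: minkowski_comb_def nonempty_polytope_def)
  then show ?case
    using mixed_volume_slot_linear[where g = g and s = 0 and t = 0, OF V g i g[of i] g[of i]]
    by (simp del: fun_upd_apply)
next
  case (insert k J)
  then show ?case
    using mixed_volume_slot_linear[where g = g and s = 1 and t = 1, OF V g i S[of k] sums[of J]]
    by (simp add: set_sum_insert del: fun_upd_apply)
qed

text \<open>Expanding the slots in \<open>I\<close> one after the other gives a sum over all functions \<open>f\<close> that choose a summand
  for every slot; \<open>g\<close> holds the contents of the remaining slots.\<close>

lemma mixed_volume_slots_expand:
  fixes g :: "nat \<Rightarrow> (real^'n::finite) set"
  assumes V: "is_mixed_volume V" and S: "\<And>k. nonempty_polytope (S k)"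
    and sums: "\<And>J. nonempty_polytope (set_sum S J)" and J: "finite J"
    and I: "finite I" "I \<subseteq> {0..<CARD('n)}" and g: "\<And>j. nonempty_polytope (g j)"
  shows "V (map (\<lambda>i. if i \<in> I then set_sum S J else g i) [0..<CARD('n)]) =
    (\<Sum>f\<in>(\<Pi>\<^sub>E i\<in>I. J). V (map (\<lambda>i. if i \<in> I then S (f i) else g i) [0..<CARD('n)]))"
  using I g
proof (induction I arbitrary: g rule: finite_induct)
  case empty
  then show ?case by simp
next
  case (insert i I)
  let ?h = "\<lambda>j. if j \<in> I then set_sum S J else g j"
  have i: "i < CARD('n)" using insert.prems(1) by auto
  have "V (map (\<lambda>j. if j \<in> insert i I then set_sum S J else g j) [0..<CARD('n)])
      = V (map (?h(i := set_sum S J)) [0..<CARD('n)])"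
    by (intro arg_cong[of _ _ V] map_cong) auto
  also have "\<dots> = (\<Sum>k\<in>J. V (map (?h(i := S k)) [0..<CARD('n)]))"
    by (rule mixed_volume_slot_sum[OF V _ i S sums J]) (use insert.prems(2) sums in auto)
  also have "\<dots> = (\<Sum>k\<in>J. \<Sum>f\<in>(\<Pi>\<^sub>E i\<in>I. J).
      V (map (\<lambda>j. if j \<in> insert i I then S ((f(i := k)) j) else g j) [0..<CARD('n)]))"
  proof (rule sum.cong[OF refl])
    fix k
    have "V (map (?h(i := S k)) [0..<CARD('n)])
        = V (map (\<lambda>j. if j \<in> I then set_sum S J else (g(i := S k)) j) [0..<CARD('n)])"
      using insert.hyps by (intro arg_cong[of _ _ V] map_cong) auto
    also have "\<dots> = (\<Sum>f\<in>(\<Pi>\<^sub>E i\<in>I. J).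
        V (map (\<lambda>j. if j \<in> I then S (f j) else (g(i := S k)) j) [0..<CARD('n)]))"
      by (rule insert.IH) (use insert.prems S in auto)
    also have "\<dots> = (\<Sum>f\<in>(\<Pi>\<^sub>E i\<in>I. J).
        V (map (\<lambda>j. if j \<in> insert i I then S ((f(i := k)) j) else g j) [0..<CARD('n)]))"
      using insert.hyps by (intro sum.cong arg_cong[of _ _ V] map_cong) auto
    finally show "V (map (?h(i := S k)) [0..<CARD('n)]) = \<dots>" .
  qed
  also have "\<dots> = (\<Sum>f\<in>(\<Pi>\<^sub>E i\<in>insert i I. J).
      V (map (\<lambda>j. if j \<in> insert i I then S (f j) else g j) [0..<CARD('n)]))"
    unfolding PiE_insert_eq sum.cartesian_product
    by (subst sum.reindex[OF inj_combinator[OF insert.hyps(2)]]) (simp add: case_prod_beta comp_def cong: if_cong)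
  finally show ?case .
qed

lemma measure_set_sum_expand:
  fixes S :: "'k \<Rightarrow> (real^'n::finite) set"
  assumes V: "is_mixed_volume V" and S: "\<And>k. nonempty_polytope (S k)"
    and sums: "\<And>J. nonempty_polytope (set_sum S J)" and J: "finite J"
  shows "measure lebesgue (set_sum S J) =
    (\<Sum>f\<in>(\<Pi>\<^sub>E i\<in>{0..<CARD('n)}. J). V (map (\<lambda>i. S (f i)) [0..<CARD('n)]))"
proof -
  let ?I = "{0..<CARD('n)}"
  have "measure lebesgue (set_sum S J) = V (replicate CARD('n) (set_sum S J))"
    using V sums unfolding is_mixed_volume_def by simp
  also have "replicate CARD('n) (set_sum S J) =
      map (\<lambda>i. if i \<in> ?I then set_sum S J else set_sum S J) [0..<CARD('n)]"
    by (simp add: map_replicate_const)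
  also have "V \<dots> = (\<Sum>f\<in>(\<Pi>\<^sub>E i\<in>?I. J).
      V (map (\<lambda>i. if i \<in> ?I then S (f i) else set_sum S J) [0..<CARD('n)]))"
    by (rule mixed_volume_slots_expand[OF V S sums J]) (use sums in auto)
  also have "\<dots> = (\<Sum>f\<in>(\<Pi>\<^sub>E i\<in>?I. J). V (map (\<lambda>i. S (f i)) [0..<CARD('n)]))"
    by (intro sum.cong arg_cong[of _ _ V] map_cong) auto
  finally show ?thesis .
qed

text \<open>Let \<open>onto T\<close> be the sum of the terms in the expansion whose choice functions have range exactly \<open>T\<close>, so
  that the volume of the partial sum over \<open>J\<close> is the sum of \<open>onto T\<close> over the subsets \<open>T\<close> of \<open>J\<close>.
  For proper \<open>J\<close> this volume is \<open>0\<close>, hence by induction \<open>onto J\<close> is \<open>0\<close>. What remains for the full sum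
  are the \<open>n!\<close> bijective choice functions, and by symmetry each of their terms is \<open>V Ps\<close>.\<close>

lemma mixed_volume_eq_measure_sum:
  fixes S :: "'n::finite \<Rightarrow> (real^'n) set"
  assumes V: "is_mixed_volume V" and S: "\<And>k. nonempty_polytope (S k)"
    and sums: "\<And>J. nonempty_polytope (set_sum S J)"
    and flat: "\<And>J. J \<noteq> UNIV \<Longrightarrow> measure lebesgue (set_sum S J) = 0"
    and Ps: "mset Ps = image_mset S (mset_set UNIV)"
  shows "fact CARD('n) * V Ps = measure lebesgue (set_sum S UNIV)"
proof -
  let ?I = "{0..<CARD('n)}"
  let ?F = "\<Pi>\<^sub>E i\<in>?I. (UNIV :: 'n set)"
  define W where "W f = V (map (\<lambda>i. S (f i)) [0..<CARD('n)])" for f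
  define onto where "onto T = (\<Sum>f | f \<in> ?F \<and> f ` ?I = T. W f)" for T
  have vol: "measure lebesgue (set_sum S J) = (\<Sum>T\<in>Pow J. onto T)" for J
  proof -
    have "measure lebesgue (set_sum S J) = (\<Sum>f\<in>(\<Pi>\<^sub>E i\<in>?I. J). W f)"
      unfolding W_def by (rule measure_set_sum_expand[OF V S sums]) simp
    also have "\<dots> = (\<Sum>T\<in>Pow J. \<Sum>f | f \<in> (\<Pi>\<^sub>E i\<in>?I. J) \<and> f ` ?I = T. W f)"
      by (rule sum.group[symmetric]) (auto intro: finite_PiE)
    also have "\<dots> = (\<Sum>T\<in>Pow J. onto T)"
      unfolding onto_def by (intro sum.cong refl) (auto simp: PiE_iff)
    finally show ?thesis .
  qed
  have onto_proper: "onto J = 0" if "J \<noteq> UNIV" for J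
    using finite[of J] that
  proof (induction J rule: finite_psubset_induct)
    case (psubset J)
    have "0 = (\<Sum>T\<in>Pow J. onto T)" using vol[of J] flat[OF psubset.prems] by simp
    also have "\<dots> = onto J + (\<Sum>T\<in>Pow J - {J}. onto T)"
      by (rule sum.remove) auto
    also have "(\<Sum>T\<in>Pow J - {J}. onto T) = 0"
      by (rule sum.neutral) (use psubset in auto)
    finally show ?case by simp
  qed
  have "measure lebesgue (set_sum S UNIV) = onto UNIV + (\<Sum>T\<in>Pow UNIV - {UNIV}. onto T)"
    unfolding vol by (rule sum.remove) auto
  also have "(\<Sum>T\<in>Pow UNIV - {UNIV}. onto T) = 0"
    by (rule sum.neutral) (use onto_proper in auto)
  finally have "measure lebesgue (set_sum S UNIV) = onto UNIV" by simp
  also have "onto UNIV = (\<Sum>f | f \<in> ?F \<and> inj_on f ?I. V Ps)"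
    unfolding onto_def
  proof (rule sum.cong)
    have "f ` ?I = UNIV \<longleftrightarrow> inj_on f ?I" for f :: "nat \<Rightarrow> 'n"
    proof
      assume "f ` ?I = UNIV"
      then show "inj_on f ?I" by (intro eq_card_imp_inj_on) simp_all
    next
      assume "inj_on f ?I"
      then have "card (f ` ?I) = CARD('n)" by (simp add: card_image)
      then show "f ` ?I = UNIV" by (intro card_subset_eq) simp_all
    qed
    then show "{f \<in> ?F. f ` ?I = UNIV} = {f \<in> ?F. inj_on f ?I}" by blast
    fix f assume "f \<in> {f \<in> ?F. inj_on f ?I}"
    then have inj: "inj_on f ?I" by simp
    then have "f ` ?I = UNIV" by (intro card_subset_eq) (simp_all add: card_image)
    then have "mset (map (\<lambda>i. S (f i)) [0..<CARD('n)]) = mset Ps"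
      unfolding Ps using arg_cong[OF image_mset_mset_set[OF inj], of "image_mset S"]
      by (simp add: image_mset.compositionality comp_def)
    moreover have "length Ps = CARD('n)" "list_all nonempty_polytope Ps"
    proof -
      show "length Ps = CARD('n)" using arg_cong[OF Ps, of size] by simp
      have "set Ps = range S" using arg_cong[OF Ps, of set_mset] by simp
      then show "list_all nonempty_polytope Ps" using S by (auto simp: list_all_iff)
    qed
    ultimately show "W f = V Ps" using V unfolding W_def is_mixed_volume_def by blast
  qed
  also have "\<dots> = of_nat (card {f \<in> ?F. inj_on f ?I}) * V Ps" by simp
  also have "card {f \<in> ?F. inj_on f ?I} = fact CARD('n)"
    by (subst card_inj_on_subset_funcset) (simp_all add: fact_prod_rev)
  finally show ?thesis by simp
qed

section \<open>Segments along a scaled lattice basis\<close>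

lemma det_of_int_Ints:
  fixes A :: "real^'n^'n"
  assumes "\<And>i j. A $ i $ j \<in> \<int>"
  shows "det A \<in> \<int>"
  unfolding det_def using assms by (intro Ints_sum Ints_mult Ints_prod Ints_of_int) auto

text \<open>A basis matrix of \<open>\<int>\<^sup>n\<close> has an integral inverse, so its determinant is a unit of \<open>\<int>\<close>.\<close>

lemma abs_det_scaled_basis:
  fixes c :: "nat \<Rightarrow> int^'n::finite" and b :: "'n \<Rightarrow> nat"
  assumes c: "lattice_basis c CARD('n) UNIV" and b: "bij_betw b UNIV {1..CARD('n)}"
    and w: "\<And>k. w k = real (d (b k)) *\<^sub>R real_vec (c (b k))"
  shows "\<bar>det (\<chi> k i. w (label k) $ label i)\<bar> = (\<Prod>i=1..CARD('n). real (d i))"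
proof -
  obtain C where C: "\<And>i j. i \<in> {1..CARD('n)} \<Longrightarrow> j \<in> {1..CARD('n)} \<Longrightarrow>
      (\<Sum>l\<in>UNIV. c i $ l * C l j) = (if i = j then 1 else 0)"
    using lattice_basis_dual[OF c] by blast
  define A :: "real^'n ranked^'n ranked" where "A = (\<chi> k i. real_of_int (c (b (label k)) $ label i))"
  define B :: "real^'n ranked^'n ranked" where "B = (\<chi> i j. real_of_int (C (label i) (b (label j))))"
  have "A ** B = mat 1"
  proof -
    have "(\<Sum>l\<in>UNIV. real_of_int (c (b (label k)) $ label l) * real_of_int (C (label l) (b (label j))))
        = (if k = j then 1 else 0)" for k j :: "'n ranked"
    proof -
      have "(\<Sum>l\<in>UNIV. c (b (label k)) $ label l * C (label l) (b (label j))) =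
          (\<Sum>l\<in>UNIV. c (b (label k)) $ l * C l (b (label j)))"
        by (rule sum.reindex_bij_betw[OF bij_label])
      also have "\<dots> = (if b (label k) = b (label j) then 1 else 0)"
        using b by (intro C) (auto simp: bij_betw_def)
      also have "\<dots> = (if k = j then 1 else 0)"
        using b by (simp add: bij_betw_def inj_eq label_inject)
      finally show ?thesis by (simp flip: of_int_mult of_int_sum)
    qed
    then show ?thesis by (simp add: A_def B_def matrix_matrix_mult_def mat_def vec_eq_iff)
  qed
  then have AB: "det A * det B = 1" by (metis det_I det_mul)
  have "det A \<in> \<int>" "det B \<in> \<int>"
    by (auto intro!: det_of_int_Ints simp: A_def B_def)
  then obtain x y :: int where "det A = of_int x" "det B = of_int y" by (auto elim!: Ints_cases)
  moreover from this AB have "x * y = 1" by (simp flip: of_int_mult)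
  ultimately have unit: "\<bar>det A\<bar> = 1" using abs_zmult_eq_1[of x y] by simp
  have "(\<chi> k i. w (label k) $ label i) = (\<chi> k. real (d (b (label k))) *s (A $ k))"
    by (simp add: A_def w real_vec_def vec_eq_iff)
  then have "det (\<chi> k i. w (label k) $ label i) = (\<Prod>k\<in>UNIV. real (d (b (label k)))) * det A"
    by (simp add: det_rows_mul)
  also have "(\<Prod>k\<in>UNIV. real (d (b (label k)))) = (\<Prod>k\<in>UNIV. real (d (b k)))"
    by (rule prod_label)
  also have "\<dots> = (\<Prod>i=1..CARD('n). real (d i))"
    by (rule prod.reindex_bij_betw[OF b])
  finally show ?thesis using unit by (simp add: abs_mult abs_prod)
qed

text \<open>The segments are indexed by the coordinates of \<open>\<real>\<^sup>n\<close> instead of the numbers from \<open>1\<close> to \<open>n\<close>, because their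
  directions become the rows of a square matrix.\<close>

lemma mixed_volume_segments:
  fixes c :: "nat \<Rightarrow> int^'n::finite" and P :: "nat \<Rightarrow> (real^'n) set"
  assumes V: "is_mixed_volume V" and c: "lattice_basis c CARD('n) UNIV"
    and P: "\<And>i. i \<in> {1..CARD('n)} \<Longrightarrow> \<exists>a. P i = closed_segment a (a + real (d i) *\<^sub>R real_vec (c i))"
  shows "fact CARD('n) * V (map P [1..<Suc CARD('n)]) = (\<Prod>i=1..CARD('n). real (d i))"
proof -
  have "\<exists>b. bij_betw b (UNIV :: 'n set) {1..CARD('n)}"
    by (rule finite_same_card_bij) simp_all
  then obtain b :: "'n \<Rightarrow> nat" where b: "bij_betw b UNIV {1..CARD('n)}" by blast
  have range: "b k \<in> {1..CARD('n)}" for k using b by (auto simp: bij_betw_def)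
  define S where "S k = P (b k)" for k
  define w where "w k = real (d (b k)) *\<^sub>R real_vec (c (b k))" for k
  have "\<exists>a. S k = closed_segment a (a + w k)" for k
    unfolding S_def w_def by (rule P[OF range])
  then obtain a where S: "\<And>k. S k = closed_segment (a k) (a k + w k)" by metis
  have "set_sum S {k} = S k" for k
    unfolding set_sum_def by auto
  then have ne: "nonempty_polytope (S k)" for k
    using nonempty_polytope_set_sum_segments[where S = S and J = "{k}", OF S] by simp
  have "mset (map P [1..<Suc CARD('n)]) = image_mset P (mset_set {1..CARD('n)})"
    by (simp only: mset_map mset_upt atLeastLessThanSuc_atLeastAtMost)
  also have "\<dots> = image_mset P (image_mset b (mset_set UNIV))"
    using b by (simp add: bij_betw_def image_mset_mset_set)
  also have "\<dots> = image_mset S (mset_set UNIV)"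
    by (simp add: image_mset.compositionality comp_def S_def[abs_def])
  finally have "fact CARD('n) * V (map P [1..<Suc CARD('n)]) = measure lebesgue (set_sum S UNIV)"
    by (intro mixed_volume_eq_measure_sum[OF V ne nonempty_polytope_set_sum_segments[where S = S, OF S]])
      (simp add: measure_set_sum_segments[where S = S, OF S])
  also have "\<dots> = \<bar>det (\<chi> k i. w (label k) $ label i)\<bar>"
    by (simp add: measure_set_sum_segments[where S = S, OF S])
  also have "\<dots> = (\<Prod>i=1..CARD('n). real (d i))"
    by (rule abs_det_scaled_basis[OF c b]) (simp add: w_def)
  finally show ?thesis .
qed

section \<open>Newton polytopes in the coordinates of the lattice\<close>

lemma matrix_vector_mult_sum:
  fixes A :: "'a::comm_ring_1^'m^'n"
  shows "A *v (\<Sum>i\<in>I. f i) = (\<Sum>i\<in>I. A *v f i)"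
  by (induction I rule: infinite_finite_induct) (simp_all add: matrix_vector_right_distrib)

text \<open>The free quotient makes the sequence split: a section \<open>\<sigma>\<close> of \<open>\<beta>\<close> gives the projection
  \<open>u - \<sigma> (\<beta> u)\<close> onto the image of \<open>\<phi>\<close>, which is then read in the coordinates of \<open>\<phi>\<close>. An integral left
  inverse of \<open>\<phi>\<close> carries over to real coefficients, as the Newton polytopes require.\<close>

lemma short_exact_left_inverse:
  fixes phi :: "int^'n^'r::finite" and beta :: "int^'r^'d::finite"
  assumes "short_exact phi beta"
  obtains psi :: "int^'r^'n" where "psi ** phi = mat 1"
proof -
  have inj: "inj ((*v) phi)" and ker: "range ((*v) phi) = {u. beta *v u = 0}"
    and surj: "surj ((*v) beta)"
    using assms by (auto simp: short_exact_def)
  have "\<exists>x. beta *v x = axis j 1" for j using surj by (metis surjD)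
  then obtain s where s: "\<And>j. beta *v s j = axis j 1" by metis
  define \<sigma> where "\<sigma> y = (\<Sum>j\<in>UNIV. y $ j *s s j)" for y :: "int^'d"
  have \<sigma>: "beta *v \<sigma> y = y" for y
  proof -
    have "beta *v \<sigma> y = (\<Sum>j\<in>UNIV. y $ j *s axis j 1)"
      unfolding \<sigma>_def by (simp add: matrix_vector_mult_sum matrix_vector_mult_smult s)
    then show ?thesis by (simp add: basis_expansion)
  qed
  have "\<exists>x. phi *v x = axis l 1 - \<sigma> (beta *v axis l 1)" for l
  proof -
    have "axis l 1 - \<sigma> (beta *v axis l 1) \<in> {u. beta *v u = 0}"
      by (simp add: \<sigma> matrix_vector_mult_diff_distrib)
    then show ?thesis unfolding ker[symmetric] by auto
  qed
  then obtain p where p: "\<And>l. phi *v p l = axis l 1 - \<sigma> (beta *v axis l 1)" by metis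
  define psi :: "int^'r^'n" where "psi = (\<chi> i l. p l $ i)"
  have psi: "psi *v u = (\<Sum>l\<in>UNIV. u $ l *s p l)" for u
    by (simp add: psi_def matrix_mult_sum column_def)
  have lin: "\<sigma> (beta *v u) = (\<Sum>l\<in>UNIV. u $ l *s \<sigma> (beta *v axis l 1))" for u
  proof -
    have "beta *v u = (\<Sum>l\<in>UNIV. u $ l *s (beta *v axis l 1))"
      by (subst basis_expansion[of u, symmetric])
        (simp only: matrix_vector_mult_sum matrix_vector_mult_smult)
    then have "\<sigma> (beta *v u) = (\<Sum>j\<in>UNIV. \<Sum>l\<in>UNIV. u $ l *s ((beta *v axis l 1) $ j *s s j))"
      by (simp add: \<sigma>_def sum_component vector_smult_assoc vec_eq_iff sum_distrib_right)
    also have "\<dots> = (\<Sum>l\<in>UNIV. \<Sum>j\<in>UNIV. u $ l *s ((beta *v axis l 1) $ j *s s j))"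
      by (rule sum.swap)
    also have "\<dots> = (\<Sum>l\<in>UNIV. u $ l *s \<sigma> (beta *v axis l 1))"
      by (simp add: \<sigma>_def vec_eq_iff sum_component sum_distrib_left mult.assoc)
    finally show ?thesis .
  qed
  have "phi *v (psi *v u) = u - \<sigma> (beta *v u)" for u
  proof -
    have "phi *v (psi *v u) = (\<Sum>l\<in>UNIV. u $ l *s axis l 1) - \<sigma> (beta *v u)"
      unfolding psi lin[of u]
      by (simp add: matrix_vector_mult_sum matrix_vector_mult_smult p vector_ssub_ldistrib sum_subtractf)
    then show ?thesis by (simp add: basis_expansion)
  qed
  moreover have "beta *v (phi *v x) = 0" for x using ker by blast
  moreover have "\<sigma> 0 = 0" by (simp add: \<sigma>_def)
  ultimately have "phi *v (psi *v (phi *v x)) = phi *v x" for x by simp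
  then have "psi *v (phi *v x) = x" for x using inj by (simp add: inj_eq)
  then have "psi ** phi = mat 1"
    by (simp add: matrix_eq matrix_vector_mul_assoc[symmetric])
  then show thesis by (rule that)
qed

lemma lattice_basis_pullback:
  fixes psi :: "int^'r^'n" and phi :: "int^'n^'r::finite"
  assumes psi: "psi ** phi = mat 1" and m: "lattice_basis m k (range ((*v) phi))"
  shows "lattice_basis (\<lambda>i. psi *v m i) k UNIV"
proof -
  have inv: "psi *v (phi *v x) = x" for x
    by (simp add: matrix_vector_mul_assoc psi)
  have comb: "psi *v (\<Sum>i=1..k. e i *s m i) = (\<Sum>i=1..k. e i *s (psi *v m i))" for e
    by (simp only: matrix_vector_mult_sum matrix_vector_mult_smult)
  show ?thesis
    unfolding lattice_basis_def
  proof (intro conjI allI impI)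
    have "\<exists>e. x = (\<Sum>i=1..k. e i *s (psi *v m i))" for x
    proof -
      obtain e where "phi *v x = (\<Sum>i=1..k. e i *s m i)" using lattice_basisE[OF m rangeI] .
      then show ?thesis using comb[of e] inv[of x] by metis
    qed
    then show "UNIV = range (\<lambda>e. \<Sum>i=1..k. e i *s (psi *v m i))" by auto
  next
    fix e :: "nat \<Rightarrow> int" assume *: "(\<Sum>i=1..k. e i *s (psi *v m i)) = 0"
    obtain x where x: "(\<Sum>i=1..k. e i *s m i) = phi *v x"
      using lattice_basis_comb_in[OF m] by (auto simp: image_iff)
    then have "x = 0" using comb[of e] inv[of x] * by simp
    then have "(\<Sum>i=1..k. e i *s m i) = 0" using x by simp
    then show "\<forall>i\<in>{1..k}. e i = 0" using m unfolding lattice_basis_def by blast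
  qed
qed

lemma keys_binomial:
  fixes u v :: "nat^'i::finite"
  assumes "u \<noteq> v"
  shows "Poly_Mapping.keys (monomial u - monomial v :: ('i, 'k::field) mpoly) = {u, v}"
  using assms
  by (auto simp: in_keys_iff lookup_minus monomial_def lookup_single when_def split: if_splits)

lemma newton_polytope_binomial:
  fixes m :: "int^'i::finite"
  assumes "m \<noteq> 0" "0 < d"
  shows "newton_polytope (monomial (d *s pos_part m) - monomial (d *s neg_part m) :: ('i, 'k::field) mpoly)
    = closed_segment (\<chi> j. real ((d *s neg_part m) $ j))
        ((\<chi> j. real ((d *s neg_part m) $ j)) + real d *\<^sub>R real_vec m)"
proof -
  obtain j where "m $ j \<noteq> 0" using assms(1) by (auto simp: vec_eq_iff)
  then have "(d *s pos_part m) $ j \<noteq> (d *s neg_part m) $ j"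
    using assms(2) by (auto simp: pos_part_def neg_part_def)
  then have neq: "d *s pos_part m \<noteq> d *s neg_part m" by metis
  have "(\<chi> j. real ((d *s pos_part m) $ j)) =
      (\<chi> j. real ((d *s neg_part m) $ j)) + real d *\<^sub>R real_vec m"
  proof (unfold vec_eq_iff, intro allI)
    fix j
    have "real (nat (m $ j)) = real (nat (- m $ j)) + real_of_int (m $ j)" by linarith
    then show "(\<chi> j. real ((d *s pos_part m) $ j)) $ j =
        ((\<chi> j. real ((d *s neg_part m) $ j)) + real d *\<^sub>R real_vec m) $ j"
      by (simp add: pos_part_def neg_part_def real_vec_def algebra_simps)
  qed
  then show ?thesis
    unfolding newton_polytope_def keys_binomial[OF neq] segment_convex_hull
    by (simp add: insert_commute)
qed

lemma identified_segment:
  fixes phi :: "int^'n^'r::finite" and psi :: "int^'r^'n"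
  assumes psi: "psi ** phi = mat 1"
    and P: "identified_via phi (closed_segment a (a + s *\<^sub>R real_vec m)) P"
  obtains a' where "P = closed_segment a' (a' + s *\<^sub>R real_vec (psi *v m))"
proof -
  let ?psi = "map_matrix real_of_int psi" and ?phi = "map_matrix real_of_int phi"
  obtain w where w: "closed_segment a (a + s *\<^sub>R real_vec m) = (\<lambda>x. w + ?phi *v x) ` P"
    using P unfolding identified_via_def by blast
  have "(\<Sum>l\<in>UNIV. psi $ i $ l * phi $ l $ j) = (if i = j then 1 else 0)" for i j
    using psi by (simp add: matrix_matrix_mult_def mat_def vec_eq_iff)
  from arg_cong[OF this, of real_of_int] have "?psi ** ?phi = mat 1"
    by (simp add: matrix_matrix_mult_def mat_def vec_eq_iff map_matrix_def)
  then have inv: "?psi *v (?phi *v x) = x" for x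
    by (simp add: matrix_vector_mul_assoc)
  have "P = (\<lambda>z. ?psi *v (z - w)) ` (\<lambda>x. w + ?phi *v x) ` P"
    by (simp add: image_image inv)
  also have "\<dots> = (*v) ?psi ` (+) (- w) ` closed_segment a (a + s *\<^sub>R real_vec m)"
    unfolding w[symmetric] image_image by simp
  also have "\<dots> = closed_segment (?psi *v (- w + a)) (?psi *v (- w + (a + s *\<^sub>R real_vec m)))"
    unfolding closed_segment_translation[symmetric]
    by (rule closed_segment_linear_image[symmetric]) simp
  also have "?psi *v real_vec m = real_vec (psi *v m)"
    by (simp add: real_vec_def vec_eq_iff matrix_vector_mult_def map_matrix_def)
  then have "?psi *v (- w + (a + s *\<^sub>R real_vec m)) = ?psi *v (- w + a) + s *\<^sub>R real_vec (psi *v m)"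
    by (simp only: add.assoc[symmetric] matrix_vector_right_distrib[of _ "- w + a"]
        matrix_vector_mult_scaleR)
  finally show thesis by (rule that)
qed

section \<open>The degree of a lattice ideal\<close>

theorem corollary6p5:
  fixes \<Sigma> :: "(real^'n::finite) set set"
    and phi :: "int^'n^'r::finite"
    and beta :: "int^'r^'d::finite"
    and L :: "(int^'r) set"
    and d :: "nat \<Rightarrow> nat"
    and m :: "nat \<Rightarrow> int^'r"
    and F :: "nat \<Rightarrow> ('r, 'k::field) mpoly"
    and P :: "nat \<Rightarrow> (real^'n) set"
    and V :: "(real^'n) set list \<Rightarrow> real"
  assumes "fan \<Sigma>" and "complete_fan \<Sigma>" and "simplicial_fan \<Sigma>"
    and "smooth_fan \<Sigma>" and "projective_fan \<Sigma>"
    and "primitive_ray_matrix \<Sigma> phi"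
    and "CARD('r) = CARD('n) + CARD('d)"
    and "short_exact phi beta"
    and "L \<subseteq> range ((*v) phi)" and "lattice_of_rank L CARD('n)"
    and "invariant_factors CARD('n) (range ((*v) phi)) L d"
    and "lattice_basis m CARD('n) (range ((*v) phi))"
    and "lattice_basis (\<lambda>i. int (d i) *s m i) CARD('n) L"
    and "\<And>i. i \<in> {1..CARD('n)} \<Longrightarrow>
           F i = monomial (d i *s pos_part (m i)) - monomial (d i *s neg_part (m i))"
    and "\<And>i. i \<in> {1..CARD('n)} \<Longrightarrow> identified_via phi (newton_polytope (F i)) (P i)"
    and "is_mixed_volume V"
  shows "(\<exists>!p. is_hilbert_polynomial \<Sigma> phi beta (lattice_ideal L :: ('r, 'k) mpoly set) p) \<and>
    (\<exists>c. hilbert_polynomial \<Sigma> phi beta (lattice_ideal L :: ('r, 'k) mpoly set) = const_poly c) \<and>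
    real_of_rat (ideal_degree \<Sigma> phi beta (lattice_ideal L :: ('r, 'k) mpoly set)) =
      fact CARD('n) * V (map P [1..<Suc CARD('n)])"
proof -
  have range_phi: "range ((*v) phi) = {u. beta *v u = 0}"
    using assms(8) by (simp add: short_exact_def)
  have pos: "0 < d i" if "i \<in> {1..CARD('n)}" for i
    using assms(11) that unfolding invariant_factors_def by blast
  have hp: "is_hilbert_polynomial \<Sigma> phi beta (lattice_ideal L :: ('r, 'k) mpoly set) p
      \<longleftrightarrow> p = const_poly (of_nat (\<Prod>i=1..CARD('n). d i))" for p
    by (rule hilbert_polynomial_lattice_ideal[where m = m])
      (use assms(1,4,5,6,8,9,12,13) pos range_phi in auto)
  then have hilb: "hilbert_polynomial \<Sigma> phi beta (lattice_ideal L :: ('r, 'k) mpoly set)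
      = const_poly (of_nat (\<Prod>i=1..CARD('n). d i))"
    unfolding hilbert_polynomial_def by (intro the_equality) simp_all
  have "(const_poly x :: ('d, rat) mpoly) = const_poly y \<longleftrightarrow> x = y" for x y
    by (metis const_poly_def lookup_single_eq)
  then have deg: "ideal_degree \<Sigma> phi beta (lattice_ideal L :: ('r, 'k) mpoly set)
      = of_nat (\<Prod>i=1..CARD('n). d i)"
    unfolding ideal_degree_def hilb by (intro the_equality) auto
  obtain psi :: "int^'r^'n" where psi: "psi ** phi = mat 1"
    using short_exact_left_inverse[OF assms(8)] by blast
  have "fact CARD('n) * V (map P [1..<Suc CARD('n)]) = (\<Prod>i=1..CARD('n). real (d i))"
  proof (rule mixed_volume_segments[OF assms(16) lattice_basis_pullback[OF psi assms(12)]])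
    fix i assume i: "i \<in> {1..CARD('n)}"
    have "m i \<noteq> 0" using lattice_basis_nonzero[OF assms(12) i] .
    then have "identified_via phi (closed_segment (\<chi> j. real ((d i *s neg_part (m i)) $ j))
        ((\<chi> j. real ((d i *s neg_part (m i)) $ j)) + real (d i) *\<^sub>R real_vec (m i))) (P i)"
      using assms(15)[OF i] assms(14)[OF i] pos[OF i] by (simp add: newton_polytope_binomial)
    then show "\<exists>a. P i = closed_segment a (a + real (d i) *\<^sub>R real_vec (psi *v m i))"
      using identified_segment[OF psi] by metis
  qed
  then show ?thesis
    using hp hilb deg by (auto simp: of_rat_prod)
qed

end
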